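(* Let $\Sigma = \{a_1, \ldots, a_k\}$ be a finite alphabet and let $\mathcal A = (\Sigma, Q, \delta, q_0, F)$ be a permutation automaton. Then $\operatorname{perm}\big(L(\mathcal A)^{ш,*}\big)$, the commutative closure of the iterated shuffle of $L(\mathcal A)$, is recognizable by an automaton with at most $$\Big( |Q|^k \prod_{j=1}^k L_j \Big) + 1$$ states, where $L_j$ for $j \in \{1,\ldots,k\}$ denotes the order of the letter $a_j$ in $\mathcal A$, and this automaton is effectively computable (from $\mathcal A$).
   Context: All automata are finite, complete and deterministic: $\mathcal A = (\Sigma, Q, \delta, q_0, F)$ with finite state set $Q$, total transition function $\delta : Q \times \Sigma \to Q$ (extended to words as usual), start state $q_0$, final states $F \subseteq Q$; $L(\mathcal A) = \{u \in \Sigma^* \mid \delta(q_0,u) \in F\}$. $\mathcal A$ is a permutation automaton if for each $a \in \Sigma$ the map $q \mapsto \delta(q,a)$ is a bijection of $Q$; the order of the letter $a$ in $\mathcal A$ is the smallest $n > 0$ with $\delta(q,a^n) = q$ for all $q \in Q$. The shuffle of words $u,v$, written $u\,ш\,v$, is the set of all words $x_1y_1x_2y_2\cdots x_ny_n$ with $x_i,y_i \in \Sigma^*$, $u = x_1\cdots x_n$, $v = y_1 \cdots y_n$; for languages, $L_1\,ш\,L_2 = \bigcup_{x \in L_1, y \in L_2} x\,ш\,y$. The iterated shuffle of $L$ is $L^{ш,*} = \bigcup_{n \ge 0} (L\,ш\cdots ш\,L)$ ($n$ copies, the case $n=0$ giving $\{\varepsilon\}$). The Parikh map is $\psi(w)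 = (|w|_{a_1},\ldots,|w|_{a_k}) \in \mathbb N_0^k$, where $|w|_a$ is the number of occurrences of $a$ in $w$. The commutative closure of $L \subseteq \Sigma^*$ is $\operatorname{perm}(L) = \{u \in \Sigma^* \mid \psi(u) = \psi(w) \text{ for some } w \in L\}$. *)

theory Defs
  imports Main "HOL-Library.Nat_Bijection"
begin

record ('a, 'q) automaton =
  alphabet :: "'a set"
  states :: "'q set"
  trans :: "'q \<Rightarrow> 'a \<Rightarrow> 'q"
  start :: 'q
  final :: "'q set"

definition automaton :: "('a, 'q) automaton \<Rightarrow> bool" where
  "automaton A \<longleftrightarrow>
     finite (alphabet A) \<and> finite (states A) \<and>
     (\<forall>q\<in>states A. \<forall>a\<in>alphabet A. trans A q a \<in> states A) \<and>
     start A \<in> states A \<and> final A \<subseteq> states A"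

definition run :: "('a, 'q) automaton \<Rightarrow> 'q \<Rightarrow> 'a list \<Rightarrow> 'q" where
  "run A q w = foldl (trans A) q w"

definition lang :: "('a, 'q) automaton \<Rightarrow> 'a list set" where
  "lang A = {u \<in> lists (alphabet A). run A (start A) u \<in> final A}"

definition permutation_automaton :: "('a, 'q) automaton \<Rightarrow> bool" where
  "permutation_automaton A \<longleftrightarrow>
     automaton A \<and> (\<forall>a\<in>alphabet A. bij_betw (\<lambda>q. trans A q a) (states A) (states A))"

definition letter_order :: "('a, 'q) automaton \<Rightarrow> 'a \<Rightarrow> nat" where
  "letter_order A a = (LEAST n. 0 < n \<and> (\<forall>q\<in>states A. run A q (replicate n a) = q))"

definition shuffle_lang :: "'a list set \<Rightarrow> 'a list set \<Rightarrow> 'a list set" where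
  "shuffle_lang K L = (\<Union>x\<in>K. \<Union>y\<in>L. shuffles x y)"

primrec shuffle_power :: "nat \<Rightarrow> 'a list set \<Rightarrow> 'a list set" where
  "shuffle_power 0 L = {[]}"
| "shuffle_power (Suc n) L = shuffle_lang L (shuffle_power n L)"

definition iterated_shuffle :: "'a list set \<Rightarrow> 'a list set" where
  "iterated_shuffle L = (\<Union>n. shuffle_power n L)"

text \<open>The alphabet is given by its enumeration \<open>as = [a\<^sub>1, \<dots>, a\<^sub>k]\<close>, so that Parikh vectors are
  lists of length \<open>k\<close>.\<close>

definition parikh :: "'a list \<Rightarrow> 'a list \<Rightarrow> nat list" where
  "parikh as w = map (count_list w) as"

definition perm :: "'a list \<Rightarrow> 'a list set \<Rightarrow> 'a list set" where
  "perm as L = {u \<in> lists (set as). \<exists>w\<in>L. parikh as u = parikh as w}"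

text \<open>\<open>recursive n g\<close>: the restriction of \<open>g\<close> to lists of length \<open>n\<close> is an \<open>n\<close>-ary total recursive
  function. Minimization is only applied to regular functions, which is what keeps the class total;
  by Kleene's normal form theorem this yields all total computable functions. The value of \<open>g\<close> on
  lists of other lengths is irrelevant.\<close>

inductive recursive :: "nat \<Rightarrow> (nat list \<Rightarrow> nat) \<Rightarrow> bool" where
  zero: "recursive n (\<lambda>xs. 0)"
| succ: "recursive 1 (\<lambda>xs. Suc (xs ! 0))"
| proj: "i < n \<Longrightarrow> recursive n (\<lambda>xs. xs ! i)"
| comp: "recursive (length hs) g \<Longrightarrow> \<forall>h\<in>set hs. recursive n h \<Longrightarrow>
    recursive n (\<lambda>xs. g (map (\<lambda>h. h xs) hs))"
| prim: "recursive n g \<Longrightarrow> recursive (n + 2) h \<Longrightarrow>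
    recursive (n + 1) (\<lambda>xs. rec_nat (g (tl xs)) (\<lambda>m r. h (m # r # tl xs)) (hd xs))"
| mini: "recursive (n + 1) g \<Longrightarrow> \<forall>xs. length xs = n \<longrightarrow> (\<exists>m. g (m # xs) = 0) \<Longrightarrow>
    recursive n (\<lambda>xs. LEAST m. g (m # xs) = 0)"

definition computable :: "(nat \<Rightarrow> nat) \<Rightarrow> bool" where
  "computable f \<longleftrightarrow> (\<exists>g. recursive 1 g \<and> (\<forall>x. f x = g [x]))"

text \<open>The code determines the automaton, up to renaming letters and states along \<open>as\<close> and
  \<open>qs\<close> and up to the irrelevant values of the transition function outside the carriers.\<close>

definition position :: "'q list \<Rightarrow> 'q \<Rightarrow> nat" where
  "position qs q = (THE i. i < length qs \<and> qs ! i = q)"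

definition automaton_code :: "'a list \<Rightarrow> 'q list \<Rightarrow> ('a, 'q) automaton \<Rightarrow> nat" where
  "automaton_code as qs A = list_encode
     [length as,
      length qs,
      position qs (start A),
      list_encode (map (\<lambda>q. if q \<in> final A then 1 else 0) qs),
      list_encode (map (\<lambda>q. list_encode (map (\<lambda>a. position qs (trans A q a)) as)) qs)]"

definition enumerates :: "'b list \<Rightarrow> 'b set \<Rightarrow> bool" where
  "enumerates xs S \<longleftrightarrow> distinct xs \<and> set xs = S"

end

theory Submission
  imports Defs
begin

text \<open>Let \<open>\<sigma> v\<close> be the set of states in which \<open>A\<close> can be after reading a word with Parikh vector
  \<open>v\<close>, where \<open>A\<close> may restart whenever it hits a final state. A nonempty word is in the language
  iff \<open>\<sigma>\<close> of its Parikh vector contains a final state. As letters act injectively,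
  \<open>card (\<sigma> v)\<close> is monotone in \<open>v\<close>, and as \<open>L a\<close> copies of \<open>a\<close> act trivially,
  \<open>\<sigma> v \<subseteq> \<sigma> (v + L a \<cdot> a)\<close>. Counting how often \<open>\<sigma>\<close> can grow in direction \<open>a\<close> shows that it is
  periodic with period \<open>L a\<close> from \<open>(|Q| - 1) L a\<close> on, uniformly in the other coordinates. So it
  suffices to count each letter up to \<open>|Q| L a - 1\<close>; the extra state is an initial state that
  accepts the empty word.

  For effectiveness: the functions that are recursive on codes are closed under composition,
  pairing, primitive recursion and folds over lists, so a functional program on lists that builds
  the automaton is recursive. Minimization is never needed, because \<open>L a\<close> is bounded by \<open>|Q|!\<close>.\<close>

section \<open>Recursive functions\<close>

text \<open>\<open>recursive\<close> speaks of one function on lists of all lengths, although only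
  length \<open>n\<close> matters. Agreement on that length alone lets functions be written with
  plain indexing.\<close>

definition recursive_on :: "nat \<Rightarrow> (nat list \<Rightarrow> nat) \<Rightarrow> bool" where
  "recursive_on n f \<longleftrightarrow> (\<exists>g. recursive n g \<and> (\<forall>xs. length xs = n \<longrightarrow> g xs = f xs))"

lemma recursive_on_nth: "i < n \<Longrightarrow> recursive_on n (\<lambda>xs. xs ! i)"
  unfolding recursive_on_def using proj by blast

lemma recursive_on_comp:
  assumes "recursive_on (length hs) g" "\<And>h. h \<in> set hs \<Longrightarrow> recursive_on n h"
  shows "recursive_on n (\<lambda>xs. g (map (\<lambda>h. h xs) hs))"
proof -
  from assms(1) obtain g' where
    g': "recursive (length hs) g'" "\<And>xs. length xs = length hs \<Longrightarrow> g' xs = g xs"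
    unfolding recursive_on_def by blast
  from assms(2) have "\<forall>h\<in>set hs. \<exists>h'. recursive n h' \<and> (\<forall>xs. length xs = n \<longrightarrow> h' xs = h xs)"
    unfolding recursive_on_def by blast
  then obtain H where
    H: "\<And>h. h \<in> set hs \<Longrightarrow> recursive n (H h)"
      "\<And>h xs. h \<in> set hs \<Longrightarrow> length xs = n \<Longrightarrow> H h xs = h xs"
    by metis
  have "recursive n (\<lambda>xs. g' (map (\<lambda>h. h xs) (map H hs)))"
    using g'(1) H(1) by (intro recursive.comp) auto
  moreover have "g' (map (\<lambda>h. h xs) (map H hs)) = g (map (\<lambda>h. h xs) hs)" if "length xs = n" for xs
    using g'(2) H(2) that by (simp cong: map_cong)
  ultimately show ?thesis
    unfolding recursive_on_def by blast
qed

lemma recursive_on_comp1: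
  "recursive_on 1 (\<lambda>xs. f (xs ! 0)) \<Longrightarrow> recursive_on n h \<Longrightarrow> recursive_on n (\<lambda>xs. f (h xs))"
  using recursive_on_comp[of "[h]" "\<lambda>xs. f (xs ! 0)" n] by simp

lemma recursive_on_comp2:
  "recursive_on 2 (\<lambda>xs. f (xs ! 0) (xs ! 1)) \<Longrightarrow> recursive_on n h1 \<Longrightarrow> recursive_on n h2 \<Longrightarrow>
    recursive_on n (\<lambda>xs. f (h1 xs) (h2 xs))"
  using recursive_on_comp[of "[h1, h2]" "\<lambda>xs. f (xs ! 0) (xs ! 1)" n]
  by (auto simp: numeral_2_eq_2)

lemma recursive_on_const: "recursive_on n (\<lambda>xs. c)"
  and recursive_on_Suc: "recursive_on n h \<Longrightarrow> recursive_on n (\<lambda>xs. Suc (h xs))"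
proof -
  have S: "recursive_on 1 (\<lambda>xs. Suc (xs ! 0))"
    unfolding recursive_on_def using succ by blast
  show Suc: "recursive_on n (\<lambda>xs. Suc (h xs))" if "recursive_on n h" for h
    using recursive_on_comp1[OF S that] .
  show "recursive_on n (\<lambda>xs. c)"
  proof (induction c)
    case 0
    show ?case unfolding recursive_on_def using zero by blast
  qed (rule Suc)
qed

text \<open>A single parameter \<open>x\<close> suffices, because pairing packs several parameters
  into one number.\<close>

lemma recursive_on_rec_nat:
  assumes "recursive_on 1 (\<lambda>xs. b (xs ! 0))" "recursive_on 3 (\<lambda>xs. s (xs ! 0) (xs ! 1) (xs ! 2))"
    and "recursive_on n t" "recursive_on n x"
  shows "recursive_on n (\<lambda>xs. rec_nat (b (x xs)) (\<lambda>m r. s m r (x xs)) (t xs))"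
proof -
  from assms(1) obtain g where
    g: "recursive 1 g" "\<And>xs. length xs = 1 \<Longrightarrow> g xs = b (xs ! 0)"
    unfolding recursive_on_def by blast
  from assms(2) obtain h where
    h: "recursive 3 h" "\<And>xs. length xs = 3 \<Longrightarrow> h xs = s (xs ! 0) (xs ! 1) (xs ! 2)"
    unfolding recursive_on_def by blast
  have h3: "h [m, r, x] = s m r x" for m r x
    using h(2)[of "[m, r, x]"] by simp
  let ?f = "\<lambda>xs. rec_nat (g (tl xs)) (\<lambda>m r. h (m # r # tl xs)) (hd xs)"
  have "recursive (1 + 1) (\<lambda>xs. rec_nat (g (tl xs)) (\<lambda>m r. h (m # r # tl xs)) (hd xs))"
  proof (rule recursive.prim)
    show "recursive 1 g" by (rule g(1))
    have "(1::nat) + 2 = 3" by simp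
    then show "recursive (1 + 2) h" using h(1) by (simp only:)
  qed
  then have "recursive 2 ?f"
    unfolding one_add_one .
  moreover have "?f xs =
      rec_nat (b (xs ! 1)) (\<lambda>m r. s m r (xs ! 1)) (xs ! 0)" if "length xs = 2" for xs
  proof -
    from that obtain t x where "xs = [t, x]"
      unfolding numeral_2_eq_2 length_Suc_conv length_0_conv by blast
    then show ?thesis by (simp add: g(2) h3)
  qed
  ultimately have "recursive_on 2 (\<lambda>xs. rec_nat (b (xs ! 1)) (\<lambda>m r. s m r (xs ! 1)) (xs ! 0))"
    unfolding recursive_on_def by (intro exI[of _ ?f] conjI allI impI)
  then show ?thesis
    using assms(3,4) by (rule recursive_on_comp2[where f = "\<lambda>t x. rec_nat (b x) (\<lambda>m r. s m r x) t"])
qed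

section \<open>Truncated arithmetic\<close>

lemma recursive_on_add:
  assumes "recursive_on n f" "recursive_on n g"
  shows "recursive_on n (\<lambda>xs. f xs + g xs)"
proof -
  have "recursive_on n (\<lambda>xs. rec_nat (g xs) (\<lambda>_ r. Suc r) (f xs))"
    by (rule recursive_on_rec_nat[where b = "\<lambda>x. x" and s = "\<lambda>_ r _. Suc r"])
      (auto intro!: recursive_on_nth recursive_on_Suc assms)
  moreover have "rec_nat b (\<lambda>_ r. Suc r) a = a + b" for a b
    by (induction a) auto
  ultimately show ?thesis by simp
qed

lemma recursive_on_pred:
  assumes "recursive_on n f"
  shows "recursive_on n (\<lambda>xs. f xs - 1)"
proof -
  have "recursive_on n (\<lambda>xs. rec_nat 0 (\<lambda>m _. m) (f xs))"
    by (rule recursive_on_rec_nat[where b = "\<lambda>x. 0" and s = "\<lambda>m _ _. m"])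
      (auto intro!: recursive_on_nth recursive_on_const assms)
  moreover have "rec_nat 0 (\<lambda>m _. m) a = a - 1" for a :: nat
    by (cases a) auto
  ultimately show ?thesis by simp
qed

lemma recursive_on_diff:
  assumes "recursive_on n f" "recursive_on n g"
  shows "recursive_on n (\<lambda>xs. f xs - g xs)"
proof -
  have "recursive_on n (\<lambda>xs. rec_nat (f xs) (\<lambda>_ r. r - 1) (g xs))"
    by (rule recursive_on_rec_nat[where b = "\<lambda>x. x" and s = "\<lambda>_ r _. r - 1"])
      (auto intro!: recursive_on_nth recursive_on_pred[simplified] assms)
  moreover have "rec_nat a (\<lambda>_ r. r - 1) b = a - b" for a b :: nat
    by (induction b) auto
  ultimately show ?thesis by simp
qed

section \<open>Cantor pairing and its inverse\<close>

lemma recursive_on_triangle: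
  assumes "recursive_on n f"
  shows "recursive_on n (\<lambda>xs. triangle (f xs))"
proof -
  have "recursive_on n (\<lambda>xs. rec_nat 0 (\<lambda>m r. r + Suc m) (f xs))"
    by (rule recursive_on_rec_nat[where b = "\<lambda>x. 0" and s = "\<lambda>m r _. r + Suc m"])
      (auto intro!: recursive_on_nth recursive_on_const recursive_on_add recursive_on_Suc assms)
  moreover have "rec_nat 0 (\<lambda>m r. r + Suc m) a = triangle a" for a
    by (induction a) auto
  ultimately show ?thesis by simp
qed

lemma recursive_on_prod_encode:
  assumes "recursive_on n f" "recursive_on n g"
  shows "recursive_on n (\<lambda>xs. prod_encode (f xs, g xs))"
  unfolding prod_encode_def prod.case
  by (intro recursive_on_add recursive_on_triangle assms)

text \<open>The index of the antidiagonal on which the pair coded by \<open>p\<close> lies.\<close>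

definition diagonal :: "nat \<Rightarrow> nat" where
  "diagonal p = rec_nat 0 (\<lambda>m r. r + (1 - (triangle (Suc r) - Suc m))) p"

text \<open>The truncated difference \<open>1 - (triangle (Suc r) - Suc m)\<close> is 1 exactly when
  \<open>Suc m\<close> has reached \<open>triangle (Suc r)\<close>, so the counter changes just
  where a new antidiagonal begins.\<close>

lemma diagonal_bounds: "triangle (diagonal p) \<le> p \<and> p < triangle (Suc (diagonal p))"
proof (induction p)
  case (Suc p)
  have "diagonal (Suc p) = diagonal p + (1 - (triangle (Suc (diagonal p)) - Suc p))"
    by (simp add: diagonal_def)
  with Suc show ?case
    by (cases "triangle (Suc (diagonal p)) = Suc p") auto
qed (simp add: diagonal_def)

text \<open>The code \<open>triangle (m + r) + m\<close> lies from \<open>triangle (m + r)\<close>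
  up to, but excluding, \<open>triangle (Suc (m + r))\<close>; as \<open>triangle\<close> is
  monotone, the intervals of different antidiagonals are disjoint.\<close>

lemma diagonal_prod_encode: "diagonal (prod_encode (m, r)) = m + r"
proof -
  have mono: "triangle i \<le> triangle j" if "i \<le> j" for i j
    using that by (induction rule: dec_induct) auto
  let ?d = "diagonal (prod_encode (m, r))"
  have 1: "triangle ?d \<le> triangle (m + r) + m" "triangle (m + r) + m < triangle (Suc ?d)"
    using diagonal_bounds[of "prod_encode (m, r)"] by (auto simp: prod_encode_def)
  have "\<not> Suc (m + r) \<le> ?d"
  proof
    assume "Suc (m + r) \<le> ?d"
    from mono[OF this] 1(1) show False by simp
  qed
  moreover have "\<not> Suc ?d \<le> m + r"
  proof
    assume "Suc ?d \<le> m + r"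
    from mono[OF this] 1(2) show False by simp
  qed
  ultimately show ?thesis by simp
qed

text \<open>Turns decoding into arithmetic on functions already known to be recursive, so the
  components are found without a search.\<close>

lemma prod_decode_diagonal:
  "fst (prod_decode p) = p - triangle (diagonal p)"
  "snd (prod_decode p) = diagonal p - (p - triangle (diagonal p))"
proof -
  obtain m r where p: "p = prod_encode (m, r)"
    by (metis prod_decode_inverse surj_pair)
  have "prod_decode p = (m, r)"
    by (simp add: p)
  moreover have "p = triangle (m + r) + m"
    by (simp add: p prod_encode_def)
  moreover have "diagonal p = m + r"
    unfolding p by (rule diagonal_prod_encode)
  ultimately show "fst (prod_decode p) = p - triangle (diagonal p)"
    "snd (prod_decode p) = diagonal p - (p - triangle (diagonal p))"
    by simp_all
qed

lemma recursive_on_diagonal: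
  assumes "recursive_on n f"
  shows "recursive_on n (\<lambda>xs. diagonal (f xs))"
  unfolding diagonal_def
  by (rule recursive_on_rec_nat[where b = "\<lambda>x. 0" and x = "\<lambda>xs. 0"
        and s = "\<lambda>m r _. r + (1 - (triangle (Suc r) - Suc m))"])
    (intro recursive_on_nth recursive_on_const recursive_on_add recursive_on_Suc
      recursive_on_diff recursive_on_triangle assms; simp)+

lemma recursive_on_prod_decode:
  assumes "recursive_on n f"
  shows "recursive_on n (\<lambda>xs. fst (prod_decode (f xs)))"
    and "recursive_on n (\<lambda>xs. snd (prod_decode (f xs)))"
  unfolding prod_decode_diagonal
  by (intro recursive_on_diff recursive_on_triangle recursive_on_diagonal assms)+

lemma computable_iff_recursive_on: "computable f \<longleftrightarrow> recursive_on 1 (\<lambda>xs. f (xs ! 0))"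
proof
  assume "computable f"
  then obtain g where "recursive 1 g" "\<And>x. f x = g [x]"
    unfolding computable_def by blast
  then show "recursive_on 1 (\<lambda>xs. f (xs ! 0))"
    unfolding recursive_on_def by (auto simp: length_Suc_conv)
next
  assume "recursive_on 1 (\<lambda>xs. f (xs ! 0))"
  then obtain g where "recursive 1 g" "\<And>xs. length xs = 1 \<Longrightarrow> g xs = f (xs ! 0)"
    unfolding recursive_on_def by blast
  then show "computable f"
    unfolding computable_def by (intro exI[of _ g]) auto
qed

lemma recursive_on_computable:
  "computable f \<Longrightarrow> recursive_on n h \<Longrightarrow> recursive_on n (\<lambda>xs. f (h xs))"
  unfolding computable_iff_recursive_on by (rule recursive_on_comp1[of f])

section \<open>Computable functions between encoded types\<close>

text \<open>Injectivity is all that is asked of a coding; it makes equality of values testable on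
  codes.\<close>

class encodable =
  fixes encode :: "'a \<Rightarrow> nat"
  assumes inj_encode: "inj encode"

lemma encode_eq_iff [simp]: "encode x = encode y \<longleftrightarrow> x = y"
  using inj_encode by (auto dest: injD)

instantiation nat :: encodable
begin
definition encode_nat :: "nat \<Rightarrow> nat" where [simp]: "encode_nat n = n"
instance by standard (auto intro: injI)
end

instantiation bool :: encodable
begin
definition encode_bool :: "bool \<Rightarrow> nat" where "encode_bool b = (if b then 1 else 0)"
instance by standard (auto intro!: injI simp: encode_bool_def split: if_splits)
end

instantiation prod :: (encodable, encodable) encodable
begin
definition encode_prod :: "'a \<times> 'b \<Rightarrow> nat" where
  "encode_prod p = prod_encode (encode (fst p), encode (snd p))"
instance by standard (auto intro!: injI simp: encode_prod_def)
end

instantiation list :: (encodable) encodable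
begin
definition encode_list :: "'a list \<Rightarrow> nat" where
  "encode_list xs = list_encode (map encode xs)"
instance
  by standard (auto intro!: injI simp: encode_list_def list_encode_eq inj_encode)
end

text \<open>The witness is constrained on codes only; its values at numbers that code nothing are
  free.\<close>

definition computes :: "('a::encodable \<Rightarrow> 'b::encodable) \<Rightarrow> bool" where
  "computes f \<longleftrightarrow> (\<exists>g. computable g \<and> (\<forall>x. g (encode x) = encode (f x)))"

named_theorems computes_intros

lemma computesI:
  assumes "recursive_on 1 (\<lambda>xs. g (xs ! 0))" "\<And>x. g (encode x) = encode (f x)"
  shows "computes f"
  using assms unfolding computes_def computable_iff_recursive_on by blast

lemma computesE:
  assumes "computes f"
  obtains g where "computable g" "\<And>x. g (encode x) = encode (f x)"
  using assms unfolding computes_def by blast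

lemma computes_id [computes_intros]: "computes (\<lambda>x. x)"
  by (rule computesI[where g = "\<lambda>x. x"]) (auto intro: recursive_on_nth)

lemma computes_const: "computes (\<lambda>x. c)"
  by (rule computesI[where g = "\<lambda>_. encode c"]) (auto intro: recursive_on_const)

lemma computes_comp:
  assumes "computes f" "computes g"
  shows "computes (\<lambda>x. f (g x))"
proof -
  from assms(1) obtain f' where f': "computable f'" "\<And>x. f' (encode x) = encode (f x)"
    by (rule computesE) blast
  from assms(2) obtain g' where g': "computable g'" "\<And>x. g' (encode x) = encode (g x)"
    by (rule computesE) blast
  show ?thesis
    by (rule computesI[where g = "\<lambda>x. f' (g' x)"])
      ((intro recursive_on_computable[OF f'(1)] recursive_on_computable[OF g'(1)] recursive_on_nth)?;
        simp add: f'(2) g'(2))+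
qed

lemma computes_Pair [computes_intros]:
  assumes "computes f" "computes g"
  shows "computes (\<lambda>x. (f x, g x))"
proof -
  from assms(1) obtain f' where f': "computable f'" "\<And>x. f' (encode x) = encode (f x)"
    by (rule computesE) blast
  from assms(2) obtain g' where g': "computable g'" "\<And>x. g' (encode x) = encode (g x)"
    by (rule computesE) blast
  show ?thesis
    by (rule computesI[where g = "\<lambda>x. prod_encode (f' x, g' x)"])
      ((intro recursive_on_computable[OF f'(1)] recursive_on_computable[OF g'(1)]
        recursive_on_prod_encode recursive_on_nth)?; simp add: f'(2) g'(2) encode_prod_def)+
qed

lemma computes_fst [computes_intros]: "computes f \<Longrightarrow> computes (\<lambda>x. fst (f x))"
  and computes_snd [computes_intros]: "computes f \<Longrightarrow> computes (\<lambda>x. snd (f x))"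
proof -
  have "computes (fst :: 'b \<times> 'c \<Rightarrow> 'b)"
    by (rule computesI[where g = "\<lambda>x. fst (prod_decode x)"])
      ((intro recursive_on_prod_decode recursive_on_nth)?; simp add: encode_prod_def)+
  moreover have "computes (snd :: 'b \<times> 'c \<Rightarrow> 'c)"
    by (rule computesI[where g = "\<lambda>x. snd (prod_decode x)"])
      ((intro recursive_on_prod_decode recursive_on_nth)?; simp add: encode_prod_def)+
  ultimately show "computes f \<Longrightarrow> computes (\<lambda>x. fst (f x))"
    "computes f \<Longrightarrow> computes (\<lambda>x. snd (f x))" for f :: "'a \<Rightarrow> 'b \<times> 'c"
    using computes_comp[of fst f] computes_comp[of snd f] by simp_all
qed

lemma computes_comp2:
  assumes "computes (\<lambda>p. h (fst p) (snd p))" "computes f" "computes g"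
  shows "computes (\<lambda>x. h (f x) (g x))"
  using computes_comp[OF assms(1) computes_Pair[OF assms(2,3)]] by simp

lemma computes_Suc [computes_intros]: "computes f \<Longrightarrow> computes (\<lambda>x. Suc (f x))"
proof (rule computes_comp[of Suc])
  show "computes Suc"
    by (rule computesI[where g = Suc]) (auto intro!: recursive_on_Suc recursive_on_nth)
qed

text \<open>The code of the whole input \<open>x\<close> is the parameter of the numerical
  recursion, so base and step may both depend on it. By induction on the counter, the recursion on
  codes follows the one on values.\<close>

lemma computes_rec_nat:
  assumes "computes b" "computes t" "computes (\<lambda>p. s (fst p) (fst (snd p)) (snd (snd p)))"
  shows "computes (\<lambda>x. rec_nat (b x) (s x) (t x))"
proof -
  from assms(1) obtain b' where b': "computable b'" "\<And>x. b' (encode x) = encode (b x)"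
    by (rule computesE) blast
  from assms(2) obtain t' where t': "computable t'" "\<And>x. t' (encode x) = encode (t x)"
    by (rule computesE) blast
  from assms(3) obtain s' where s': "computable s'"
    "\<And>p. s' (encode p) = encode (s (fst p) (fst (snd p)) (snd (snd p)))"
    by (rule computesE) blast
  have s'': "s' (prod_encode (encode x, prod_encode (m, encode r))) = encode (s x m r)" for x m r
    using s'(2)[of "(x, m, r)"] by (simp add: encode_prod_def)
  show ?thesis
  proof (rule computesI[where g =
        "\<lambda>x. rec_nat (b' x) (\<lambda>m r. s' (prod_encode (x, prod_encode (m, r)))) (t' x)"])
    show "recursive_on 1 (\<lambda>xs. rec_nat (b' (xs ! 0))
        (\<lambda>m r. s' (prod_encode (xs ! 0, prod_encode (m, r)))) (t' (xs ! 0)))"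
      by (rule recursive_on_rec_nat[where b = b' and x = "\<lambda>xs. xs ! 0"
            and s = "\<lambda>m r x. s' (prod_encode (x, prod_encode (m, r)))"])
        (intro recursive_on_computable[OF b'(1)] recursive_on_computable[OF s'(1)]
          recursive_on_computable[OF t'(1)] recursive_on_prod_encode recursive_on_nth; simp)+
    have "rec_nat (encode (b x)) (\<lambda>m r. s' (prod_encode (encode x, prod_encode (m, r)))) n =
        encode (rec_nat (b x) (s x) n)" for x n
      by (induction n) (simp_all add: s'')
    then show "rec_nat (b' (encode x))
        (\<lambda>m r. s' (prod_encode (encode x, prod_encode (m, r)))) (t' (encode x)) =
        encode (rec_nat (b x) (s x) (t x))" for x
      using t'(2)[of x] by (simp add: b')
  qed
qed

lemma computes_encode [computes_intros]: "computes f \<Longrightarrow> computes (\<lambda>x. encode (f x))"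
  by (erule computesE) (auto intro!: computesI simp: computable_iff_recursive_on)

text \<open>Truth values are coded by 0 and 1, so a recursion of that length returns its base for
  false and takes a single step for true.\<close>

lemma computes_If [computes_intros]:
  assumes "computes b" "computes f" "computes g"
  shows "computes (\<lambda>x. if b x then f x else g x)"
proof -
  have "computes (\<lambda>x. rec_nat (g x) (\<lambda>_ _. f x) (encode (b x)))"
    by (rule computes_rec_nat[where s = "\<lambda>x _ _. f x"])
      (intro assms computes_intros computes_comp[OF assms(2)])+
  moreover have "rec_nat (g x) (\<lambda>_ _. f x) (encode (b x)) = (if b x then f x else g x)" for x
    by (simp add: encode_bool_def)
  ultimately show ?thesis by simp
qed

lemmas [computes_intros] = computes_const computes_rec_nat

section \<open>Connectives, equality and arithmetic\<close>

lemma computes_Not [computes_intros]: "computes f \<Longrightarrow> computes (\<lambda>x. \<not> f x)"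
proof -
  assume "computes f"
  then have "computes (\<lambda>x. if f x then False else True)"
    by (intro computes_intros)
  moreover have "(\<lambda>x. if f x then False else True) = (\<lambda>x. \<not> f x)" by auto
  ultimately show ?thesis by simp
qed

lemma computes_conj [computes_intros]:
  assumes "computes f" "computes g"
  shows "computes (\<lambda>x. f x \<and> g x)"
proof -
  have "computes (\<lambda>x. if f x then g x else False)"
    by (intro computes_intros assms)
  moreover have "(\<lambda>x. if f x then g x else False) = (\<lambda>x. f x \<and> g x)" by auto
  ultimately show ?thesis by simp
qed

lemma computes_disj [computes_intros]:
  assumes "computes f" "computes g"
  shows "computes (\<lambda>x. f x \<or> g x)"
proof -
  have "computes (\<lambda>x. \<not> (\<not> f x \<and> \<not> g x))"
    by (intro computes_intros assms)
  then show ?thesis by simp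
qed

text \<open>Values are equal iff their codes are. For numbers, the sum of both truncated differences
  vanishes exactly on equality, and subtracting it from 1 gives the truth value.\<close>

lemma computes_eq [computes_intros]:
  fixes f g :: "'a::encodable \<Rightarrow> 'b::encodable"
  assumes "computes f" "computes g"
  shows "computes (\<lambda>x. f x = g x)"
proof -
  have "computes (\<lambda>p :: nat \<times> nat. fst p = snd p)"
  proof (rule computesI[where g = "\<lambda>x. 1 - (fst (prod_decode x) - snd (prod_decode x) +
        (snd (prod_decode x) - fst (prod_decode x)))"])
    show "recursive_on 1 (\<lambda>xs. 1 - (fst (prod_decode (xs ! 0)) - snd (prod_decode (xs ! 0)) +
        (snd (prod_decode (xs ! 0)) - fst (prod_decode (xs ! 0)))))"
      by (intro recursive_on_diff recursive_on_add recursive_on_prod_decode recursive_on_const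
          recursive_on_nth) simp_all
  qed (auto simp: encode_prod_def encode_bool_def)
  from computes_comp2[OF this computes_encode[OF assms(1)] computes_encode[OF assms(2)]]
  show ?thesis by simp
qed

lemma computes_add [computes_intros]:
  fixes f g :: "'a::encodable \<Rightarrow> nat"
  assumes "computes f" "computes g"
  shows "computes (\<lambda>x. f x + g x)"
proof -
  have "computes (\<lambda>x. rec_nat (g x) (\<lambda>_ r. Suc r) (f x))"
    by (intro computes_intros assms)
  moreover have "rec_nat b (\<lambda>_ r. Suc r) a = a + b" for a b
    by (induction a) auto
  ultimately show ?thesis by simp
qed

lemma computes_mult [computes_intros]:
  fixes f g :: "'a::encodable \<Rightarrow> nat"
  assumes "computes f" "computes g"
  shows "computes (\<lambda>x. f x * g x)"
proof -
  have "computes (\<lambda>x. rec_nat 0 (\<lambda>_ r. g x + r) (f x))"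
    by (intro computes_intros computes_comp[OF assms(2)] assms(1))
  moreover have "rec_nat 0 (\<lambda>_ r. b + r) a = a * b" for a b :: nat
    by (induction a) auto
  ultimately show ?thesis by simp
qed

lemma computes_pred [computes_intros]:
  fixes f :: "'a::encodable \<Rightarrow> nat"
  assumes "computes f"
  shows "computes (\<lambda>x. f x - 1)"
proof -
  have "computes (\<lambda>x. rec_nat 0 (\<lambda>m _. m) (f x))"
    by (intro computes_intros assms)
  moreover have "rec_nat 0 (\<lambda>m _. m) a = a - 1" for a :: nat
    by (cases a) auto
  ultimately show ?thesis by simp
qed

lemma computes_fact [computes_intros]:
  fixes f :: "'a::encodable \<Rightarrow> nat"
  assumes "computes f"
  shows "computes (\<lambda>x. fact (f x) :: nat)"
proof -
  have "computes (\<lambda>x. rec_nat 1 (\<lambda>m r. Suc m * r) (f x))"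
    by (intro computes_intros assms)
  moreover have "rec_nat 1 (\<lambda>m r. Suc m * r) a = fact a" for a :: nat
    by (induction a) auto
  ultimately show ?thesis by simp
qed

section \<open>Functions on lists\<close>

lemma encode_Nil [simp]: "encode [] = 0"
  and encode_Cons [simp]: "encode (x # xs) = Suc (prod_encode (encode x, encode xs))"
  by (simp_all add: encode_list_def)

lemma computes_list_encode [computes_intros]: "computes f \<Longrightarrow> computes (\<lambda>x. list_encode (f x))"
  using computes_encode[of f] by (simp add: encode_list_def map_idI)

text \<open>On lists of numbers \<open>encode\<close> is \<open>list_encode\<close>, so on the level
  of codes decoding is the identity.\<close>

lemma computes_list_decode [computes_intros]:
  assumes "computes f"
  shows "computes (\<lambda>x. list_decode (f x))"
proof -
  have "computes list_decode"
    by (rule computesI[where g = "\<lambda>x. x"])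
      (auto intro: recursive_on_nth simp: encode_list_def map_idI)
  from computes_comp[OF this assms] show ?thesis .
qed

lemma computes_Cons [computes_intros]:
  assumes "computes f" "computes g"
  shows "computes (\<lambda>x. f x # g x)"
proof -
  have "computes (\<lambda>p. fst p # snd p)"
    by (rule computesI[where g = Suc])
      (auto intro!: recursive_on_Suc recursive_on_nth simp: encode_prod_def)
  from computes_comp2[OF this assms] show ?thesis .
qed

lemma computes_tl [computes_intros]:
  fixes f :: "'a::encodable \<Rightarrow> 'b::encodable list"
  assumes "computes f"
  shows "computes (\<lambda>x. tl (f x))"
proof -
  \<comment> \<open>Covers the empty list: its code 0 has predecessor 0, whose second component 0 is
    the code of \<open>tl []\<close>.\<close>
  have "prod_decode 0 = (0, 0)"
    by (simp add: prod_decode_def prod_decode_aux.simps)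
  then have "snd (prod_decode (encode xs - 1)) = encode (tl xs)" for xs :: "'b list"
    by (cases xs) auto
  then have "computes (tl :: 'b list \<Rightarrow> _)"
    by (intro computesI[where g = "\<lambda>x. snd (prod_decode (x - 1))"] recursive_on_prod_decode
        recursive_on_pred recursive_on_nth) auto
  from computes_comp[OF this assms] show ?thesis .
qed

text \<open>The recursion is a mere case distinction: code 0 returns the fixed code of the
  unspecified value \<open>hd []\<close>, and code \<open>Suc m\<close> decodes
  \<open>m\<close>.\<close>

lemma computes_hd [computes_intros]:
  fixes f :: "'a::encodable \<Rightarrow> 'b::encodable list"
  assumes "computes f"
  shows "computes (\<lambda>x. hd (f x))"
proof -
  let ?c = "encode (hd [] :: 'b)"
  let ?g = "\<lambda>x. rec_nat ?c (\<lambda>m _. fst (prod_decode m)) x"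
  have "?g (encode xs) = encode (hd xs)" for xs :: "'b list"
    by (cases xs) auto
  moreover have "recursive_on 1 (\<lambda>xs. ?g (xs ! 0))"
    by (rule recursive_on_rec_nat[where b = "\<lambda>_. ?c" and x = "\<lambda>_. 0"
          and s = "\<lambda>m _ _. fst (prod_decode m)"])
      (intro recursive_on_const recursive_on_prod_decode recursive_on_nth; simp)+
  ultimately have "computes (hd :: 'b list \<Rightarrow> _)"
    by (intro computesI[where g = ?g])
  from computes_comp[OF this assms] show ?thesis .
qed

text \<open>Makes the code of a list a computable bound on the number of iterations of a fold over
  it.\<close>

lemma length_le_encode: "length xs \<le> encode xs"
proof (induction xs)
  case (Cons x xs)
  then show ?case using le_prod_encode_2[of "encode xs" "encode x"] by simp
qed simp

text \<open>The state holds the accumulator and the unread rest. Once the rest is empty the step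
  does nothing, so any upper bound on the length can serve as iteration count.\<close>

lemma foldl_conv_rec_nat:
  assumes "length xs \<le> n"
  shows "foldl f a xs = fst (rec_nat (a, xs)
    (\<lambda>_ st. if snd st = [] then st else (f (fst st) (hd (snd st)), tl (snd st))) n)"
    (is "_ = fst (rec_nat _ (\<lambda>_. ?step) n)")
proof -
  \<comment> \<open>Peels off the first iteration instead of the last, matching the order in which
    \<open>foldl\<close> consumes the list.\<close>
  have shift: "rec_nat st (\<lambda>_. ?step) (Suc n) = rec_nat (?step st) (\<lambda>_. ?step) n" for st n
    by (induction n) simp_all
  show ?thesis
    using assms
  proof (induction n arbitrary: a xs)
    case (Suc n)
    show ?case
    proof (cases xs)
      case Nil
      with Suc.IH[of "[]" a] show ?thesis by (simp only: shift) simp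
    next
      case (Cons y ys)
      with Suc.IH[of ys "f a y"] Suc.prems show ?thesis by (simp only: shift) simp
    qed
  qed simp
qed

lemma computes_foldl [computes_intros]:
  assumes "computes a" "computes l" "computes (\<lambda>p. s (fst p) (fst (snd p)) (snd (snd p)))"
  shows "computes (\<lambda>x. foldl (s x) (a x) (l x))"
proof -
  have s: "computes (\<lambda>x. s (f x) (g x) (h x))"
    if "computes f" "computes g" "computes h" for f g h
    using computes_comp[OF assms(3) computes_Pair[OF that(1) computes_Pair[OF that(2,3)]]]
    by simp
  show ?thesis
    unfolding foldl_conv_rec_nat[OF length_le_encode]
    by (intro computes_intros s assms(1,2))
qed

lemma computes_rev [computes_intros]:
  assumes "computes l"
  shows "computes (\<lambda>x. rev (l x))"
proof -
  have "computes (\<lambda>x. foldl (\<lambda>r y. y # r) [] (l x))"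
    by (intro computes_intros assms)
  then show ?thesis by (simp add: rev_conv_fold foldl_conv_fold)
qed

lemma computes_foldr [computes_intros]:
  assumes "computes l" "computes a" "computes (\<lambda>p. s (fst p) (fst (snd p)) (snd (snd p)))"
  shows "computes (\<lambda>x. foldr (s x) (l x) (a x))"
proof -
  have s: "computes (\<lambda>x. s (f x) (g x) (h x))"
    if "computes f" "computes g" "computes h" for f g h
    using computes_comp[OF assms(3) computes_Pair[OF that(1) computes_Pair[OF that(2,3)]]]
    by simp
  show ?thesis
    unfolding foldr_conv_foldl by (intro computes_intros s assms(1,2))
qed

lemma computes_map [computes_intros]:
  assumes "computes l" "computes (\<lambda>p. f (fst p) (snd p))"
  shows "computes (\<lambda>x. map (f x) (l x))"
proof -
  have "computes (\<lambda>x. foldr (\<lambda>y r. f x y # r) (l x) [])"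
    by (intro computes_intros assms(1) computes_comp2[OF assms(2)])
  moreover have "foldr (\<lambda>y r. f x y # r) xs [] = map (f x) xs" for x xs
    by (induction xs) auto
  ultimately show ?thesis by simp
qed

lemma computes_filter [computes_intros]:
  assumes "computes l" "computes (\<lambda>p. f (fst p) (snd p))"
  shows "computes (\<lambda>x. filter (f x) (l x))"
proof -
  have "computes (\<lambda>x. foldr (\<lambda>y r. if f x y then y # r else r) (l x) [])"
    by (intro computes_intros assms(1) computes_comp2[OF assms(2)])
  moreover have "foldr (\<lambda>y r. if f x y then y # r else r) xs [] = filter (f x) xs" for x xs
    by (induction xs) auto
  ultimately show ?thesis by simp
qed

lemma computes_append [computes_intros]:
  assumes "computes f" "computes g"
  shows "computes (\<lambda>x. f x @ g x)"
proof -
  have "computes (\<lambda>x. foldr (\<lambda>y r. y # r) (f x) (g x))"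
    by (intro computes_intros assms)
  moreover have "foldr (\<lambda>y r. y # r) xs ys = xs @ ys" for xs ys :: "'b list"
    by (induction xs) auto
  ultimately show ?thesis by simp
qed

lemma computes_concat [computes_intros]:
  assumes "computes f"
  shows "computes (\<lambda>x. concat (f x))"
  unfolding concat_conv_foldr by (intro computes_intros assms)

lemma computes_length [computes_intros]:
  assumes "computes f"
  shows "computes (\<lambda>x. length (f x))"
proof -
  have "computes (\<lambda>x. foldr (\<lambda>_ r. Suc r) (f x) 0)"
    by (intro computes_intros assms)
  moreover have "foldr (\<lambda>_ r. Suc r) xs 0 = length xs" for xs :: "'b list"
    by (induction xs) auto
  ultimately show ?thesis by simp
qed

lemma computes_list_ex [computes_intros]:
  assumes "computes l" "computes (\<lambda>p. f (fst p) (snd p))"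
  shows "computes (\<lambda>x. list_ex (f x) (l x))"
proof -
  have "computes (\<lambda>x. filter (f x) (l x) \<noteq> [])"
    by (intro computes_intros assms)
  then show ?thesis by (simp add: filter_empty_conv list_ex_iff)
qed

lemma computes_list_all [computes_intros]:
  assumes "computes l" "computes (\<lambda>p. f (fst p) (snd p))"
  shows "computes (\<lambda>x. list_all (f x) (l x))"
proof -
  have "computes (\<lambda>x. \<not> list_ex (\<lambda>y. \<not> f x y) (l x))"
    by (intro computes_intros assms(1) computes_comp2[OF assms(2)])
  then show ?thesis by (simp add: list_ex_iff list_all_iff)
qed

lemma computes_sum_list [computes_intros]:
  fixes f :: "'a::encodable \<Rightarrow> nat list"
  assumes "computes f"
  shows "computes (\<lambda>x. sum_list (f x))"
  unfolding sum_list.eq_foldr by (intro computes_intros assms)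

lemma computes_upt [computes_intros]:
  assumes "computes f"
  shows "computes (\<lambda>x. [0..<f x])"
proof -
  have "computes (\<lambda>x. rec_nat [] (\<lambda>m r. r @ [m]) (f x))"
    by (intro computes_intros assms)
  moreover have "rec_nat [] (\<lambda>m r. r @ [m]) n = [0..<n]" for n
    by (induction n) auto
  ultimately show ?thesis by simp
qed

lemma computes_drop [computes_intros]:
  assumes "computes n" "computes f"
  shows "computes (\<lambda>x. drop (n x) (f x))"
proof -
  have "computes (\<lambda>x. rec_nat (f x) (\<lambda>_ r. tl r) (n x))"
    by (intro computes_intros assms)
  moreover have "rec_nat xs (\<lambda>_ r. tl r) n = drop n xs" for n and xs :: "'b list"
    by (induction n) (auto simp: drop_Suc tl_drop)
  ultimately show ?thesis by simp
qed

lemma computes_product_lists [computes_intros]: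
  assumes "computes f"
  shows "computes (\<lambda>x. product_lists (f x))"
proof -
  have "computes (\<lambda>x. foldr (\<lambda>xs r. concat (map (\<lambda>y. map (\<lambda>ys. y # ys) r) xs)) (f x) [[]])"
    by (intro computes_intros assms)
  moreover have "foldr (\<lambda>xs r. concat (map (\<lambda>y. map (\<lambda>ys. y # ys) r) xs)) xss [[]] =
      product_lists xss" for xss :: "'b list list"
    by (induction xss) auto
  ultimately show ?thesis by simp
qed

section \<open>The program\<close>

text \<open>Out of range, \<open>xs ! i\<close> is an unknown value that may depend on \<open>xs\<close> and \<open>i\<close>, whereas \<open>hd []\<close> is
  a constant; this makes \<open>entry\<close> computable on all arguments.\<close>

definition entry :: "'b list \<Rightarrow> nat \<Rightarrow> 'b" where
  "entry xs i = hd (drop i xs)"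

lemma entry_nth: "i < length xs \<Longrightarrow> entry xs i = xs ! i"
  by (simp add: entry_def hd_drop_conv_nth)

lemma computes_entry [computes_intros]:
  assumes "computes f" "computes i"
  shows "computes (\<lambda>x. entry (f x) (i x))"
  unfolding entry_def by (intro computes_intros assms)

text \<open>Computable substitute for \<open>position\<close>, which is a definite description; both
  agree on members of distinct lists.\<close>

definition index_of :: "'b list \<Rightarrow> 'b \<Rightarrow> nat" where
  "index_of xs x = foldr (\<lambda>y r. if y = x then 0 else Suc r) xs 0"

lemma computes_index_of [computes_intros]:
  assumes "computes f" "computes g"
  shows "computes (\<lambda>x. index_of (f x) (g x))"
  unfolding index_of_def by (intro computes_intros computes_comp[OF assms(2)] assms(1))

text \<open>Rows are indexed by state numbers and columns by letter numbers; the entries are the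
  numbers of the successor states.\<close>

type_synonym table = "nat list list"

definition step :: "table \<Rightarrow> nat \<Rightarrow> nat \<Rightarrow> nat" where
  "step d q j = entry (entry d q) j"

lemma computes_step [computes_intros]:
  assumes "computes d" "computes q" "computes j"
  shows "computes (\<lambda>x. step (d x) (q x) (j x))"
  unfolding step_def by (intro computes_intros assms)

text \<open>The \<open>fact n\<close>-th power of any permutation of \<open>n\<close> points is the
  identity, so a search up to \<open>fact n\<close> succeeds; the candidates ascend, hence the first
  hit is the least.\<close>

definition order_of :: "table \<Rightarrow> nat \<Rightarrow> nat \<Rightarrow> nat" where
  "order_of d n j = hd (filter
    (\<lambda>m. list_all (\<lambda>q. rec_nat q (\<lambda>_ r. step d r j) m = q) [0..<n]) (map Suc [0..<fact n]))"

lemma computes_order_of [computes_intros]: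
  assumes "computes d" "computes n" "computes j"
  shows "computes (\<lambda>x. order_of (d x) (n x) (j x))"
  unfolding order_of_def
  by (intro computes_intros assms(2) computes_comp[OF assms(1)] computes_comp[OF assms(2)]
      computes_comp[OF assms(3)])

section \<open>Exploring pairs of a Parikh vector and a state\<close>

definition increment :: "nat \<Rightarrow> nat list \<Rightarrow> nat \<Rightarrow> nat list" where
  "increment k v j = map (\<lambda>i. if i = j then Suc (entry v i) else entry v i) [0..<k]"

lemma computes_increment [computes_intros]:
  assumes "computes k" "computes v" "computes j"
  shows "computes (\<lambda>x. increment (k x) (v x) (j x))"
  unfolding increment_def
  by (intro computes_intros assms(1) computes_comp[OF assms(2)] computes_comp[OF assms(3)])

text \<open>The second, conditional pair is the restart: having entered a final state, the automaton
  may continue from its start state \<open>s\<close>.\<close>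

definition successors ::
  "table \<Rightarrow> nat \<Rightarrow> nat \<Rightarrow> nat list \<Rightarrow> nat list \<times> nat \<Rightarrow> nat \<Rightarrow> (nat list \<times> nat) list" where
  "successors d k s fin p j = (increment k (fst p) j, step d (snd p) j) #
     (if entry fin (step d (snd p) j) = 1 then [(increment k (fst p) j, s)] else [])"

lemma computes_successors [computes_intros]:
  assumes "computes d" "computes k" "computes s" "computes fin" "computes p" "computes j"
  shows "computes (\<lambda>x. successors (d x) (k x) (s x) (fin x) (p x) (j x))"
  unfolding successors_def by (intro computes_intros assms)

text \<open>Each round reads one more letter, so round \<open>m\<close> treats the vectors with
  coordinate sum \<open>m\<close>, and \<open>accepting\<close> inspects a single round.\<close>

definition reachable_list ::
  "table \<Rightarrow> nat \<Rightarrow> nat \<Rightarrow> nat list \<Rightarrow> nat \<Rightarrow> (nat list \<times> nat) list" where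
  "reachable_list d k s fin m = rec_nat [(map (\<lambda>_. 0) [0..<k], s)]
     (\<lambda>_ r. concat (map (\<lambda>p. concat (map (\<lambda>j. successors d k s fin p j) [0..<k])) r)) m"

lemma computes_reachable_list [computes_intros]:
  assumes "computes d" "computes k" "computes s" "computes fin" "computes m"
  shows "computes (\<lambda>x. reachable_list (d x) (k x) (s x) (fin x) (m x))"
  unfolding reachable_list_def
  by (intro computes_intros assms(2,3,5) computes_comp[OF assms(1)] computes_comp[OF assms(2)]
      computes_comp[OF assms(3)] computes_comp[OF assms(4)])

definition accepting :: "table \<Rightarrow> nat \<Rightarrow> nat \<Rightarrow> nat list \<Rightarrow> nat list \<Rightarrow> bool" where
  "accepting d k s fin v \<longleftrightarrow>
     list_ex (\<lambda>p. fst p = v \<and> entry fin (snd p) = 1) (reachable_list d k s fin (sum_list v))"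

lemma computes_accepting [computes_intros]:
  assumes "computes d" "computes k" "computes s" "computes fin" "computes v"
  shows "computes (\<lambda>x. accepting (d x) (k x) (s x) (fin x) (v x))"
  unfolding accepting_def
  by (intro computes_intros assms computes_comp[OF assms(4)] computes_comp[OF assms(5)])

text \<open>A counter per letter that runs through \<open>n\<close> blocks of one period each and
  then falls back to the beginning of the last block.\<close>

definition wrap :: "table \<Rightarrow> nat \<Rightarrow> nat \<Rightarrow> nat list \<Rightarrow> nat \<Rightarrow> nat list" where
  "wrap d n k v j = map (\<lambda>i. if i = j
     then (if Suc (entry v i) = n * order_of d n i then (n - 1) * order_of d n i
       else Suc (entry v i))
     else entry v i) [0..<k]"

lemma computes_wrap [computes_intros]:
  assumes "computes d" "computes n" "computes k" "computes v" "computes j"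
  shows "computes (\<lambda>x. wrap (d x) (n x) (k x) (v x) (j x))"
  unfolding wrap_def
  by (intro computes_intros assms(3) computes_comp[OF assms(1)] computes_comp[OF assms(2)]
      computes_comp[OF assms(4)] computes_comp[OF assms(5)])

section \<open>States and code of the resulting automaton\<close>

definition vectors :: "table \<Rightarrow> nat \<Rightarrow> nat \<Rightarrow> nat list list" where
  "vectors d n k = product_lists (map (\<lambda>j. [0..<n * order_of d n j]) [0..<k])"

lemma computes_vectors [computes_intros]:
  assumes "computes d" "computes n" "computes k"
  shows "computes (\<lambda>x. vectors (d x) (n x) (k x))"
  unfolding vectors_def
  by (intro computes_intros assms(3) computes_comp[OF assms(1)] computes_comp[OF assms(2)])

text \<open>\<open>0\<close> is the additional initial state.\<close>

definition state_names :: "table \<Rightarrow> nat \<Rightarrow> nat \<Rightarrow> nat list" where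
  "state_names d n k = 0 # map (\<lambda>v. Suc (list_encode v)) (vectors d n k)"

lemma computes_state_names [computes_intros]:
  assumes "computes d" "computes n" "computes k"
  shows "computes (\<lambda>x. state_names (d x) (n x) (k x))"
  unfolding state_names_def by (intro computes_intros assms)

text \<open>The additional state 0 also carries the zero vector and therefore moves like it; only
  acceptance can tell the two apart.\<close>

definition vector_of :: "nat \<Rightarrow> nat \<Rightarrow> nat list" where
  "vector_of k q = (if q = 0 then map (\<lambda>_. 0) [0..<k] else list_decode (q - 1))"

lemma computes_vector_of [computes_intros]:
  assumes "computes k" "computes q"
  shows "computes (\<lambda>x. vector_of (k x) (q x))"
  unfolding vector_of_def by (intro computes_intros assms)

text \<open>Follows \<open>automaton_code\<close> field by field, with states numbered by their
  place in \<open>state_names\<close>.\<close>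

definition closure_code ::
  "nat \<Rightarrow> nat \<Rightarrow> nat \<Rightarrow> nat list \<Rightarrow> table \<Rightarrow> nat" where
  "closure_code k n s fin d = list_encode
     [k,
      length (state_names d n k),
      0,
      list_encode (map (\<lambda>q. if q = 0 \<or> accepting d k s fin (vector_of k q) then 1 else 0)
        (state_names d n k)),
      list_encode (map (\<lambda>q. list_encode (map
          (\<lambda>j. index_of (state_names d n k) (Suc (list_encode (wrap d n k (vector_of k q) j))))
          [0..<k]))
        (state_names d n k))]"

lemma computes_closure_code [computes_intros]:
  assumes "computes k" "computes n" "computes s" "computes fin" "computes d"
  shows "computes (\<lambda>x. closure_code (k x) (n x) (s x) (fin x) (d x))"
  unfolding closure_code_def
  by (intro computes_intros assms computes_comp[OF assms(1)] computes_comp[OF assms(2)]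
      computes_comp[OF assms(3)] computes_comp[OF assms(4)] computes_comp[OF assms(5)])

definition closure_program :: "nat \<Rightarrow> nat" where
  "closure_program c = closure_code
     (entry (list_decode c) 0) (entry (list_decode c) 1) (entry (list_decode c) 2)
     (list_decode (entry (list_decode c) 3))
     (map list_decode (list_decode (entry (list_decode c) 4)))"

lemma computable_closure_program: "computable closure_program"
proof -
  have "computes closure_program"
    unfolding closure_program_def by (intro computes_intros)
  then obtain g where "computable g" "\<And>x. g x = closure_program x"
    by (auto elim: computesE)
  then show ?thesis by (metis ext)
qed

section \<open>Reachable sets along Parikh vectors\<close>

lemma run_append [simp]: "run A q (u @ w) = run A (run A q u) w"
  and run_Nil [simp]: "run A q [] = q"
  and run_Cons [simp]: "run A q (a # w) = run A (trans A q a) w"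
  by (simp_all add: run_def)

lemma run_replicate: "run A q (replicate m a) = ((\<lambda>q. trans A q a) ^^ m) q"
  by (induction m arbitrary: q) (simp_all add: funpow_swap1[of "\<lambda>q. trans A q a"])

text \<open>The orbit of \<open>x\<close> repeats within its first \<open>card S + 1\<close>
  members. Injectivity cancels the common initial iterations, leaving a period of at most
  \<open>card S\<close>, which divides the factorial.\<close>

lemma funpow_fact_card:
  assumes "finite S" "bij_betw f S S" "x \<in> S"
  shows "(f ^^ fact (card S)) x = x"
proof -
  have in_S: "(f ^^ i) y \<in> S" if "y \<in> S" for i y
    using assms(2) that by (induction i) (auto dest: bij_betwE)
  have inj: "inj_on (f ^^ i) S" for i
  proof (induction i)
    case (Suc i)
    have "inj_on f S"
      using assms(2) by (rule bij_betw_imp_inj_on)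
    then have "inj_on f ((f ^^ i) ` S)"
      by (rule inj_on_subset) (auto simp: in_S)
    with Suc show ?case
      using comp_inj_on[of "f ^^ i" S f] by (simp add: o_def)
  qed simp
  \<comment> \<open>Pigeonhole: \<open>{..card S}\<close> has one element more than
    \<open>S\<close>.\<close>
  have "\<not> inj_on (\<lambda>i. (f ^^ i) x) {..card S}"
  proof
    assume "inj_on (\<lambda>i. (f ^^ i) x) {..card S}"
    then have "card {..card S} \<le> card S"
      by (rule card_inj_on_le) (auto simp: in_S assms)
    then show False by simp
  qed
  then obtain i j where ij: "i < j" "j \<le> card S" "(f ^^ i) x = (f ^^ j) x"
    by (auto simp: inj_on_def) (metis linorder_neqE_nat)
  have "(f ^^ i) ((f ^^ (j - i)) x) = (f ^^ i) x"
    using ij by (simp flip: funpow_add[THEN fun_cong, unfolded o_apply])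
  then have period: "(f ^^ (j - i)) x = x"
    using inj in_S[OF assms(3)] assms(3) by (auto dest: inj_onD)
  have "j - i dvd fact (card S)"
    using ij by (intro dvd_fact) auto
  then obtain c where "fact (card S) = (j - i) * c" ..
  moreover have "((f ^^ (j - i)) ^^ c) x = x"
    using period by (induction c) auto
  ultimately show ?thesis
    by (simp add: funpow_mult)
qed

text \<open>A restart replaces the final state just entered by the start state within the same
  letter. So each step reads exactly one letter, and the coordinate sum counts the steps.\<close>

inductive reach :: "('a, 'q) automaton \<Rightarrow> ('a \<Rightarrow> nat) \<Rightarrow> 'q \<Rightarrow> bool" for A where
  init: "reach A (\<lambda>_. 0) (start A)"
| move: "reach A v q \<Longrightarrow> a \<in> alphabet A \<Longrightarrow> reach A (v(a := Suc (v a))) (trans A q a)"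
| restart: "reach A v q \<Longrightarrow> a \<in> alphabet A \<Longrightarrow> trans A q a \<in> final A \<Longrightarrow>
    reach A (v(a := Suc (v a))) (start A)"

definition reached :: "('a, 'q) automaton \<Rightarrow> ('a \<Rightarrow> nat) \<Rightarrow> 'q set" where
  "reached A v = {q. reach A v q}"

locale perm_automaton =
  fixes A :: "('a, 'q) automaton"
  assumes perm_aut: "permutation_automaton A"
begin

abbreviation "n \<equiv> card (states A)"
abbreviation "L \<equiv> letter_order A"

lemma automaton: "automaton A"
  using perm_aut by (simp add: permutation_automaton_def)

lemma finite_states: "finite (states A)"
  and finite_alphabet: "finite (alphabet A)"
  and start_in: "start A \<in> states A"
  and trans_in: "q \<in> states A \<Longrightarrow> a \<in> alphabet A \<Longrightarrow> trans A q a \<in> states A"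
  using automaton by (auto simp: automaton_def)

lemma bij_trans: "a \<in> alphabet A \<Longrightarrow> bij_betw (\<lambda>q. trans A q a) (states A) (states A)"
  using perm_aut by (simp add: permutation_automaton_def)

lemma card_states_pos: "0 < n"
  using finite_states start_in by (auto simp: card_gt_0_iff)

text \<open>The exponent \<open>fact n\<close> acts trivially, so the least such exponent exists and
  is at most \<open>fact n\<close>.\<close>

lemma letter_order:
  assumes "a \<in> alphabet A"
  shows "0 < L a" and "q \<in> states A \<Longrightarrow> run A q (replicate (L a) a) = q"
    and "L a \<le> fact n"
proof -
  let ?P = "\<lambda>m. 0 < m \<and> (\<forall>q\<in>states A. run A q (replicate m a) = q)"
  have P: "?P (fact n)"
    using funpow_fact_card[OF finite_states bij_trans[OF assms]] by (simp add: run_replicate)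
  from LeastI[of ?P, OF P] have "?P (L a)"
    unfolding letter_order_def .
  then show "0 < L a" and "q \<in> states A \<Longrightarrow> run A q (replicate (L a) a) = q"
    by auto
  show "L a \<le> fact n"
    unfolding letter_order_def by (rule Least_le[of ?P, OF P])
qed

lemma reach_in_states: "reach A v q \<Longrightarrow> q \<in> states A"
  by (induction rule: reach.induct) (auto simp: start_in trans_in)

lemma reached_subset: "reached A v \<subseteq> states A"
  by (auto simp: reached_def reach_in_states)

lemma finite_reached: "finite (reached A v)"
  using reached_subset finite_states by (rule finite_subset)

lemma reach_outside: "reach A v q \<Longrightarrow> b \<notin> alphabet A \<Longrightarrow> v b = 0"
  by (induction rule: reach.induct) auto

section \<open>Growth and periodicity of the reached sets\<close>

lemma card_reached_step:
  assumes "a \<in> alphabet A"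
  shows "card (reached A v) \<le> card (reached A (v(a := Suc (v a))))"
proof (rule card_inj_on_le)
  show "inj_on (\<lambda>q. trans A q a) (reached A v)"
    using bij_trans[OF assms] reached_subset by (meson bij_betw_def inj_on_subset)
  show "(\<lambda>q. trans A q a) ` reached A v \<subseteq> reached A (v(a := Suc (v a)))"
    using assms by (auto simp: reached_def intro: reach.move)
qed (rule finite_reached)

text \<open>Reading \<open>L a\<close> further copies of \<open>a\<close> without any restart leads
  back to the same state.\<close>

lemma reached_add_order:
  assumes "a \<in> alphabet A"
  shows "reached A v \<subseteq> reached A (v(a := v a + L a))"
proof
  fix q assume "q \<in> reached A v"
  then have q: "reach A v q" by (simp add: reached_def)
  have "reach A (v(a := v a + m)) (run A q (replicate m a))" for m
  proof (induction m)
    case (Suc m)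
    from reach.move[OF this assms] show ?case
      by (simp del: fun_upd_apply add: fun_upd_same flip: replicate_append_same)
  qed (use q in simp)
  from this[of "L a"] show "q \<in> reached A (v(a := v a + L a))"
    using letter_order(2)[OF assms reach_in_states[OF q]] by (simp add: reached_def)
qed

text \<open>Base of the growth count: as the automaton is complete, every vector over the alphabet
  is that of a readable word.\<close>

lemma reached_nonempty:
  assumes "\<And>b. b \<notin> alphabet A \<Longrightarrow> v b = 0"
  shows "reached A v \<noteq> {}"
  using assms
proof (induction "sum v (alphabet A)" arbitrary: v)
  case 0
  have "v b = 0" for b
    using 0 finite_alphabet by (cases "b \<in> alphabet A") simp_all
  then have "v = (\<lambda>_. 0)" by blast
  then show ?case
    using reach.init by (auto simp: reached_def)
next
  case (Suc m)
  then obtain a where a: "a \<in> alphabet A" "0 < v a"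
    using sum.not_neutral_contains_not_neutral[of v "alphabet A"] by force
  let ?w = "v(a := v a - 1)"
  have "sum v (alphabet A) = v a + sum v (alphabet A - {a})"
    "sum ?w (alphabet A) = ?w a + sum ?w (alphabet A - {a})"
    by (rule sum.remove[OF finite_alphabet a(1)])+
  moreover have "sum ?w (alphabet A - {a}) = sum v (alphabet A - {a})"
    by (rule sum.cong) auto
  ultimately have "m = sum ?w (alphabet A)"
    using Suc(2) a(2) by simp
  moreover have "?w b = 0" if "b \<notin> alphabet A" for b
    using Suc(3) that a(1) by auto
  ultimately have "reached A ?w \<noteq> {}"
    by (rule Suc(1))
  then obtain q where "reach A ?w q"
    by (auto simp: reached_def)
  from reach.move[OF this a(1)] show ?case
    using a(2) by (auto simp: reached_def)
qed

text \<open>A reached set is determined by those of the immediate predecessors of its vector.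
  Inclusions between shifted and unshifted predecessors, in direction \<open>a\<close> and in all
  others, thus pass on to the next vector.\<close>

lemma reached_Suc_stable:
  assumes a: "a \<in> alphabet A"
    and same: "reached A (v(a := v a + d)) \<subseteq> reached A v"
    and other: "\<And>b. b \<in> alphabet A \<Longrightarrow> b \<noteq> a \<Longrightarrow> 0 < v b \<Longrightarrow>
      reached A (v(b := v b - 1, a := Suc (v a) + d)) \<subseteq> reached A (v(b := v b - 1, a := Suc (v a)))"
  shows "reached A (v(a := Suc (v a) + d)) \<subseteq> reached A (v(a := Suc (v a)))"
proof
  let ?w = "v(a := Suc (v a) + d)" and ?w' = "v(a := Suc (v a))"
  \<comment> \<open>The last step of a derivation for the shifted vector can be repeated with the
    same letter from a predecessor of the unshifted one.\<close>
  have pred: "\<exists>y. reach A y p \<and> ?w' = y(b := Suc (y b))"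
    if "reach A u p" "b \<in> alphabet A" "?w = u(b := Suc (u b))" for u p b
  proof (cases "b = a")
    case True
    have "u = v(a := v a + d)"
    proof
      fix c show "u c = (v(a := v a + d)) c"
        using fun_cong[OF that(3), of c] True by (cases "c = a") auto
    qed
    then have "reach A v p" using that(1) same by (auto simp: reached_def)
    with True show ?thesis by blast
  next
    case False
    have b: "v b = Suc (u b)"
      using fun_cong[OF that(3), of b] False by simp
    then have b_pos: "0 < v b" by simp
    have "u = v(b := v b - 1, a := Suc (v a) + d)"
    proof
      fix c show "u c = (v(b := v b - 1, a := Suc (v a) + d)) c"
        using fun_cong[OF that(3), of c] False b by (cases "c = b"; cases "c = a") auto
    qed
    let ?y = "v(b := v b - 1, a := Suc (v a))"
    have "p \<in> reached A ?y"
      using that(1) other[OF that(2) False b_pos] unfolding \<open>u = _\<close> reached_def by blast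
    moreover have "?w' = ?y(b := Suc (?y b))"
      using False b by auto
    ultimately show ?thesis unfolding reached_def by blast
  qed
  fix q assume "q \<in> reached A ?w"
  then have "reach A ?w q" by (simp add: reached_def)
  then show "q \<in> reached A ?w'"
  proof cases
    case init
    from fun_cong[OF this(1), of a] show ?thesis by simp
  next
    case (move u p b)
    from pred[OF move(3,4,1)] obtain y where "reach A y p" and y: "?w' = y(b := Suc (y b))"
      by blast
    with reach.move[of A y p b] move show ?thesis
      unfolding y by (simp add: reached_def)
  next
    case (restart u p b)
    from pred[OF restart(3,4,1)] obtain y where "reach A y p" and y: "?w' = y(b := Suc (y b))"
      by blast
    with reach.restart[of A y p b] restart show ?thesis
      unfolding y by (simp add: reached_def)
  qed
qed

text \<open>Along the row of \<open>p\<close> in direction \<open>a\<close>, each block of length \<open>L a\<close> either enlarges the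
  reached set or starts a periodic tail. Once a predecessor row is not periodic, its reached sets
  are large, and letters being injective this lower bound carries over to the present row.\<close>

lemma reached_large_or_stable:
  assumes a: "a \<in> alphabet A" and "\<And>b. b \<notin> alphabet A \<Longrightarrow> p b = 0" and "t * L a \<le> m"
  shows "t < card (reached A (p(a := m))) \<or>
    0 < t \<and> (\<forall>m'\<ge>m - L a. reached A (p(a := m' + L a)) = reached A (p(a := m')))"
  using assms(2,3)
\<comment> \<open>The outer induction counts the letters other than \<open>a\<close>, as each
  predecessor row has one fewer; the inner one counts the blocks \<open>t\<close>.\<close>
proof (induction "sum p (alphabet A - {a})" arbitrary: p t m rule: less_induct)
  case less
  show ?case
    using less.prems(2)
  proof (induction t arbitrary: m)
    case 0
    have "reached A (p(a := m)) \<noteq> {}"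
      using less.prems(1) a by (intro reached_nonempty) auto
    then show ?case
      using card_gt_0_iff[of "reached A (p(a := m))"] finite_reached by blast
  next
    case (Suc t)
    have Lm: "L a \<le> m" and tm: "t * L a \<le> m - L a" using Suc.prems by auto
    show ?case
    proof (cases "Suc t < card (reached A (p(a := m)))")
      case small: False
      \<comment> \<open>The set in the predecessor row is no larger than the present one, hence has
        at most \<open>Suc t\<close> elements; the outer hypothesis leaves only periodicity for that
        row.\<close>
      have preds: "reached A (p(b := p b - 1, a := m' + L a)) = reached A (p(b := p b - 1, a := m'))"
        if b: "b \<in> alphabet A" "b \<noteq> a" "0 < p b" and m': "m - L a \<le> m'" for b m'
      proof -
        let ?p = "p(b := p b - 1)"
        have "sum ?p (alphabet A - {a}) < sum p (alphabet A - {a})"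
          using b finite_alphabet by (intro sum_strict_mono_ex1) auto
        moreover have "\<And>c. c \<notin> alphabet A \<Longrightarrow> ?p c = 0"
          using less.prems(1) by auto
        ultimately have "Suc t < card (reached A (?p(a := m))) \<or>
          (\<forall>m'\<ge>m - L a. reached A (?p(a := m' + L a)) = reached A (?p(a := m')))"
          using less.hyps[of ?p "Suc t" m] Suc.prems by blast
        moreover have "card (reached A (?p(a := m))) \<le> card (reached A (p(a := m)))"
        proof -
          have "(?p(a := m))(b := Suc ((?p(a := m)) b)) = p(a := m)"
            using b by auto
          with card_reached_step[OF b(1), of "?p(a := m)"] show ?thesis by simp
        qed
        ultimately show ?thesis using small m' by auto
      qed
      have "reached A (p(a := m' + L a)) = reached A (p(a := m'))" if "m - L a \<le> m'" for m'
        using Suc.IH[OF tm]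
      proof
        assume "0 < t \<and> (\<forall>m'\<ge>m - L a - L a. reached A (p(a := m' + L a)) = reached A (p(a := m')))"
        with that show ?thesis by auto
      next
        assume t: "t < card (reached A (p(a := m - L a)))"
        from that show ?thesis
        proof (induction rule: dec_induct)
          case base
          have "reached A (p(a := m - L a)) \<subseteq> reached A (p(a := m))"
            using reached_add_order[OF a, of "p(a := m - L a)"] Lm by simp
          \<comment> \<open>One block earlier there are at least \<open>Suc t\<close> states, now at
            most \<open>Suc t\<close>, so the inclusion is an equality.\<close>
          then have "reached A (p(a := m - L a)) = reached A (p(a := m))"
            using t small finite_reached by (intro card_seteq) auto
          with Lm show ?case by (simp del: fun_upd_apply)
        next
          case (step i)
          \<comment> \<open>Periodicity at \<open>i\<close> in this row and at \<open>Suc i\<close>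
            in the predecessor rows gives periodicity at \<open>Suc i\<close> here.\<close>
          have "reached A ((p(a := i))(a := Suc ((p(a := i)) a) + L a)) \<subseteq>
              reached A ((p(a := i))(a := Suc ((p(a := i)) a)))"
          proof (rule reached_Suc_stable[OF a])
            show "reached A ((p(a := i))(a := (p(a := i)) a + L a)) \<subseteq> reached A (p(a := i))"
              using step(3) by (simp del: fun_upd_apply add: fun_upd_same)
            fix b assume "b \<in> alphabet A" "b \<noteq> a" "0 < (p(a := i)) b"
            with preds[of b "Suc i"] step(1)
            show "reached A ((p(a := i))(b := (p(a := i)) b - 1, a := Suc ((p(a := i)) a) + L a))
              \<subseteq> reached A ((p(a := i))(b := (p(a := i)) b - 1, a := Suc ((p(a := i)) a)))"
              by (simp add: fun_upd_twist)
          qed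
          moreover have "reached A (p(a := Suc i)) \<subseteq> reached A (p(a := Suc i + L a))"
            using reached_add_order[OF a, of "p(a := Suc i)"] by simp
          ultimately have "reached A (p(a := Suc i + L a)) = reached A (p(a := Suc i))" by auto
          then show ?case by (simp del: fun_upd_apply)
        qed
      qed
      then show ?thesis by blast
    next
      case True
      then show ?thesis by blast
    qed
  qed
qed

text \<open>After \<open>n\<close> blocks the set would need more than \<open>n\<close> states to be
  still growing; so it is periodic from one block earlier on, whatever the other coordinates
  are.\<close>

lemma reached_periodic:
  assumes a: "a \<in> alphabet A" and "\<And>b. b \<notin> alphabet A \<Longrightarrow> v b = 0" and "(n - 1) * L a \<le> v a"
  shows "reached A (v(a := v a + L a)) = reached A v"
proof -
  have "\<not> n < card (reached A (v(a := n * L a)))"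
    using card_mono[OF finite_states reached_subset] by (simp add: not_less)
  with reached_large_or_stable[OF a, where p = v and t = n and m = "n * L a"] assms(2)
  have "\<forall>m'\<ge>n * L a - L a. reached A (v(a := m' + L a)) = reached A (v(a := m'))"
    by blast
  with assms(3) show ?thesis by (simp add: diff_mult_distrib)
qed

section \<open>Reachability and the iterated shuffle\<close>

lemma reach_start: "reach A v q \<Longrightarrow> q \<in> final A \<Longrightarrow> reach A v (start A)"
  \<comment> \<open>A final state entered by \<open>move\<close> can be exchanged for the start
    state by \<open>restart\<close>; in the other cases the state is the start state
    already.\<close>
  by (cases rule: reach.cases) (auto intro: reach.intros)

lemma reach_run:
  assumes "reach A v (start A)" "w \<in> lists (alphabet A)"
  shows "reach A (\<lambda>b. v b + count_list w b) (run A (start A) w)"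
  using assms(2)
proof (induction w rule: rev_induct)
  case (snoc a w)
  let ?v = "\<lambda>b. v b + count_list w b"
  have "?v(a := Suc (?v a)) = (\<lambda>b. v b + count_list (w @ [a]) b)"
    by (auto simp: fun_eq_iff count_list_append)
  with snoc reach.move[of A ?v "run A (start A) w" a] show ?case by simp
qed (use assms(1) in simp)

lemma count_list_shuffles:
  "zs \<in> shuffles xs ys \<Longrightarrow> count_list zs b = count_list xs b + count_list ys b"
  by (induction xs ys arbitrary: zs rule: shuffles.induct) auto

lemma append_in_shuffles: "xs @ ys \<in> shuffles xs ys"
  by (induction xs) (auto simp: Cons_in_shuffles_rightI Cons_in_shuffles_leftI)

text \<open>Only letter counts matter, so the factors of a shuffle can be read one after another,
  with a restart after each.\<close>

lemma reach_shuffle_power: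
  "w \<in> shuffle_power m (lang A) \<Longrightarrow> reach A (count_list w) (start A) \<and>
    (if m = 0 then w = [] else \<exists>q\<in>final A. reach A (count_list w) q)"
proof (induction m arbitrary: w)
  case 0
  then show ?case using reach.init[of A] by simp
next
  case (Suc m)
  then obtain x y where xy: "x \<in> lang A" "y \<in> shuffle_power m (lang A)" "w \<in> shuffles x y"
    by (auto simp: shuffle_lang_def)
  have "reach A (\<lambda>b. count_list y b + count_list x b) (run A (start A) x)"
    using Suc.IH[OF xy(2)] xy(1) by (intro reach_run) (auto simp: lang_def)
  moreover have "(\<lambda>b. count_list y b + count_list x b) = count_list w"
    using count_list_shuffles[OF xy(3)] by auto
  ultimately have "reach A (count_list w) (run A (start A) x)" by simp
  moreover have "run A (start A) x \<in> final A" using xy(1) by (simp add: lang_def)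
  ultimately show ?case using reach_start by auto
qed

text \<open>\<open>y\<close> gathers the factors completed so far and \<open>x\<close> is what was
  read since the last restart; a restart moves \<open>x\<close> with its new letter into
  \<open>y\<close>, concatenation being a special shuffle.\<close>

lemma reach_imp_shuffle_power:
  "reach A v q \<Longrightarrow> \<exists>m x y. y \<in> shuffle_power m (lang A) \<and> x \<in> lists (alphabet A) \<and>
    run A (start A) x = q \<and> v = (\<lambda>b. count_list x b + count_list y b)"
proof (induction rule: reach.induct)
  case init
  show ?case by (intro exI[of _ 0] exI[of _ "[]"]) auto
next
  case (move v q a)
  then obtain m x y where xy: "y \<in> shuffle_power m (lang A)" "x \<in> lists (alphabet A)"
    "run A (start A) x = q" "v = (\<lambda>b. count_list x b + count_list y b)" by blast
  with move(2) show ?case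
    by (intro exI[of _ m] exI[of _ "x @ [a]"] exI[of _ y]) (auto simp: count_list_append fun_eq_iff)
next
  case (restart v q a)
  then obtain m x y where xy: "y \<in> shuffle_power m (lang A)" "x \<in> lists (alphabet A)"
    "run A (start A) x = q" "v = (\<lambda>b. count_list x b + count_list y b)" by blast
  with restart(2,3) have "x @ [a] \<in> lang A" by (auto simp: lang_def)
  with xy(1) have "(x @ [a]) @ y \<in> shuffle_power (Suc m) (lang A)"
    using append_in_shuffles[of "x @ [a]" y] by (auto simp: shuffle_lang_def)
  then show ?case
    by (intro exI[of _ "Suc m"] exI[of _ "[]"] exI[of _ "(x @ [a]) @ y"])
      (auto simp: xy(4) count_list_append fun_eq_iff)
qed

text \<open>The empty word is treated apart: it is the shuffle of zero factors even if the start
  state is not final.\<close>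

lemma perm_iterated_shuffle:
  assumes "set as = alphabet A"
  shows "u \<in> perm as (iterated_shuffle (lang A)) \<longleftrightarrow>
    u \<in> lists (alphabet A) \<and> (u = [] \<or> reached A (count_list u) \<inter> final A \<noteq> {})"
    (is "_ \<longleftrightarrow> ?R")
proof
  assume "u \<in> perm as (iterated_shuffle (lang A))"
  then obtain w m where u: "u \<in> lists (alphabet A)" and w: "w \<in> shuffle_power m (lang A)"
    and "parikh as u = parikh as w"
    by (auto simp: perm_def iterated_shuffle_def assms)
  then have eq: "count_list u b = count_list w b" if "b \<in> alphabet A" for b
    using that by (auto simp: parikh_def assms)
  note reach = reach_shuffle_power[OF w]
  \<comment> \<open>\<open>parikh\<close> compares only the letters of \<open>as\<close>; all others
    occur in neither word.\<close>
  have "count_list u b = count_list w b" for b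
  proof (cases "b \<in> alphabet A")
    case False
    then have "count_list w b = 0" using reach reach_outside by blast
    moreover have "count_list u b = 0" using u False by (auto simp: count_list_0_iff)
    ultimately show ?thesis by simp
  qed (rule eq)
  then have count: "count_list u = count_list w" by blast
  show ?R
  proof (cases "m = 0")
    case True
    with reach count have "count_list u (hd u) = 0" by simp
    then have "u = []" by (cases u) auto
    with u show ?thesis by simp
  next
    case False
    with reach u count show ?thesis by (auto simp: reached_def)
  qed
next
  assume R: ?R
  show "u \<in> perm as (iterated_shuffle (lang A))"
  proof (cases "u = []")
    case True
    have "[] \<in> shuffle_power 0 (lang A)" by simp
    then have "[] \<in> iterated_shuffle (lang A)" unfolding iterated_shuffle_def by blast
    with True show ?thesis by (auto simp: perm_def)
  next
    case False
    with R obtain q where q: "reach A (count_list u) q" "q \<in> final A"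
      by (auto simp: reached_def)
    from reach_imp_shuffle_power[OF q(1)] obtain m x y where
      xy: "y \<in> shuffle_power m (lang A)" "x \<in> lists (alphabet A)" "run A (start A) x = q"
        "count_list u = (\<lambda>b. count_list x b + count_list y b)" by blast
    from xy q(2) have "x @ y \<in> shuffle_power (Suc m) (lang A)"
      using append_in_shuffles[of x y] by (auto simp: shuffle_lang_def lang_def)
    then have "x @ y \<in> iterated_shuffle (lang A)" unfolding iterated_shuffle_def by blast
    moreover have "parikh as u = parikh as (x @ y)"
      by (simp add: parikh_def xy(4) count_list_append)
    ultimately show ?thesis using R by (auto simp: perm_def assms)
  qed
qed

text \<open>A counter with preperiod \<open>(n - 1) * L a\<close> and period \<open>L a\<close>;
  \<open>wrap\<close> is its form on lists.\<close>

definition advance :: "('a \<Rightarrow> nat) \<Rightarrow> 'a \<Rightarrow> 'a \<Rightarrow> nat" where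
  "advance w a = w(a := if Suc (w a) = n * L a then (n - 1) * L a else Suc (w a))"

lemma advance_bound:
  assumes "a \<in> alphabet A" "w a < n * L a"
  shows "advance w a a < n * L a"
proof -
  have "(n - 1) * L a < n * L a"
    using card_states_pos letter_order(1)[OF assms(1)] by simp
  with assms show ?thesis by (auto simp: advance_def)
qed

text \<open>The offset \<open>x\<close> makes the induction work: letters yet to be truncated wait
  in it, and periodicity holds for all values of the other coordinates.\<close>

lemma reached_advance:
  assumes u: "u \<in> lists (alphabet A)" and "\<And>b. b \<notin> alphabet A \<Longrightarrow> x b = 0"
  shows "reached A (\<lambda>b. count_list u b + x b) = reached A (\<lambda>b. foldl advance (\<lambda>_. 0) u b + x b)"
  using assms
proof (induction u arbitrary: x rule: rev_induct)
  case (snoc a u)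
  \<comment> \<open>The last letter moves into the offset, where the induction hypothesis for
    \<open>u\<close> keeps it.\<close>
  let ?w = "foldl advance (\<lambda>_. 0) u" and ?x = "x(a := Suc (x a))"
  let ?y = "\<lambda>b. advance ?w a b + x b"
  have a: "a \<in> alphabet A" and u: "u \<in> lists (alphabet A)" using snoc by auto
  have w0: "?w b = 0" if "b \<notin> alphabet A" for b
    using u that by (induction u rule: rev_induct) (auto simp: advance_def)
  have "reached A (\<lambda>b. count_list (u @ [a]) b + x b) = reached A (\<lambda>b. count_list u b + ?x b)"
    by (rule arg_cong[of _ _ "reached A"]) (auto simp: count_list_append)
  also have "\<dots> = reached A (\<lambda>b. ?w b + ?x b)"
  proof (rule snoc.IH[OF u])
    fix b assume "b \<notin> alphabet A"
    with snoc.prems(2) a show "?x b = 0" by auto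
  qed
  also have "\<dots> = reached A ?y"
  proof (cases "Suc (?w a) = n * L a")
    case True
    \<comment> \<open>Wrapping lowers coordinate \<open>a\<close> by one period to a value still in
      the periodic range.\<close>
    have "(n - 1) * L a + L a = n * L a"
      using card_states_pos by (cases n) auto
    then have "(\<lambda>b. ?w b + ?x b) = ?y(a := ?y a + L a)"
      using True by (auto simp: advance_def fun_eq_iff)
    moreover have "reached A (?y(a := ?y a + L a)) = reached A ?y"
      using a True w0 snoc.prems(2) by (intro reached_periodic) (auto simp: advance_def)
    ultimately show ?thesis by simp
  next
    case False
    then have "(\<lambda>b. ?w b + ?x b) = ?y"
      by (auto simp: advance_def fun_eq_iff)
    then show ?thesis by simp
  qed
  finally show ?case by simp
qed simp

lemma reached_count_list:
  "u \<in> lists (alphabet A) \<Longrightarrow> reached A (count_list u) = reached A (foldl advance (\<lambda>_. 0) u)"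
  using reached_advance[of u "\<lambda>_. 0"] by simp

end

section \<open>Correctness of the program\<close>

lemma position_eq:
  assumes "distinct xs" "i < length xs" "xs ! i = x"
  shows "position xs x = i"
  unfolding position_def
proof (rule the_equality)
  fix j assume "j < length xs \<and> xs ! j = x"
  with assms show "j = i" using nth_eq_iff_index_eq[of xs j i] by simp
qed (use assms in simp)

lemma
  assumes "distinct xs" "x \<in> set xs"
  shows position_less: "position xs x < length xs" and nth_position: "xs ! position xs x = x"
proof -
  from assms(2) obtain i where i: "i < length xs" "xs ! i = x"
    unfolding in_set_conv_nth by blast
  with position_eq[OF assms(1) i] show "position xs x < length xs" "xs ! position xs x = x"
    by simp_all
qed

lemma position_eq_iff:
  assumes "distinct xs" "x \<in> set xs" "y \<in> set xs"
  shows "position xs x = position xs y \<longleftrightarrow> x = y"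
proof
  assume "position xs x = position xs y"
  then have "xs ! position xs x = xs ! position xs y" by (rule arg_cong)
  then show "x = y" by (simp only: nth_position assms)
qed (rule arg_cong)

lemma index_of_eq_position:
  assumes "distinct xs" "x \<in> set xs"
  shows "index_of xs x = position xs x"
proof -
  have "index_of xs x < length xs \<and> xs ! index_of xs x = x"
    using assms(2) by (induction xs) (auto simp: index_of_def)
  then show ?thesis by (intro position_eq[symmetric] assms(1)) simp_all
qed

locale enumerated_automaton = perm_automaton A for A :: "('a, 'q) automaton" +
  fixes as :: "'a list" and qs :: "'q list"
  assumes enum_as: "enumerates as (alphabet A)" and enum_qs: "enumerates qs (states A)"
begin

lemma as: "distinct as" "set as = alphabet A" and qs: "distinct qs" "set qs = states A"
  using enum_as enum_qs by (auto simp: enumerates_def)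

lemma length_qs: "length qs = n"
  using distinct_card[OF qs(1)] qs(2) by simp

abbreviation "k \<equiv> length as"
abbreviation "pos \<equiv> position qs"

text \<open>\<open>fin\<close> and \<open>d\<close> are the acceptance flags and the transition
  table that \<open>closure_program\<close> decodes.\<close>

definition "fin = map (\<lambda>q. if q \<in> final A then 1 else 0 :: nat) qs"
definition "d = map (\<lambda>q. map (\<lambda>a. pos (trans A q a)) as) qs"

lemma pos_less: "q \<in> states A \<Longrightarrow> pos q < n"
  and nth_pos: "q \<in> states A \<Longrightarrow> qs ! pos q = q"
  using position_less[of qs q] nth_position[of qs q] qs length_qs by auto

lemma as_nth: "j < k \<Longrightarrow> as ! j \<in> alphabet A"
  using nth_mem[of j as] as(2) by simp

lemma step_d:
  assumes "q \<in> states A" "j < k"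
  shows "step d (pos q) j = pos (trans A q (as ! j))"
proof -
  have "pos q < length qs"
    using pos_less[OF assms(1)] length_qs by simp
  then have "entry d (pos q) = map (\<lambda>a. pos (trans A q a)) as"
    by (simp add: d_def entry_nth nth_pos[OF assms(1)])
  with assms(2) show ?thesis
    by (simp add: step_def entry_nth)
qed

lemma entry_fin:
  assumes "q \<in> states A"
  shows "entry fin (pos q) = (if q \<in> final A then 1 else 0)"
proof -
  have "pos q < length qs"
    using pos_less[OF assms] length_qs by simp
  then show ?thesis
    by (simp add: fin_def entry_nth nth_pos[OF assms])
qed

lemma closure_program_code:
  "closure_program (automaton_code as qs A) = closure_code k n (pos (start A)) fin d"
  by (simp add: closure_program_def automaton_code_def entry_nth length_qs fin_def d_def o_def
      numeral_eq_Suc)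

lemma order_of_d:
  assumes "j < k"
  shows "order_of d n j = L (as ! j)"
proof -
  note a = as_nth[OF assms]
  have iter: "rec_nat (pos q) (\<lambda>_ r. step d r j) m = pos (run A q (replicate m (as ! j))) \<and>
      run A q (replicate m (as ! j)) \<in> states A" if "q \<in> states A" for q m
    using that by (induction m)
      (simp_all add: step_d assms a trans_in flip: replicate_append_same)
  have "list_all (\<lambda>q. rec_nat q (\<lambda>_ r. step d r j) m = q) [0..<n] \<longleftrightarrow>
      (\<forall>q\<in>states A. run A q (replicate m (as ! j)) = q)" (is "?l \<longleftrightarrow> ?r") for m
  proof -
    \<comment> \<open>Testing all numbers below \<open>n\<close> is thus the same as testing all
      states.\<close>
    have "{..<n} = pos ` states A"
    proof
      show "{..<n} \<subseteq> pos ` states A"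
      proof
        fix i assume "i \<in> {..<n}"
        then have "pos (qs ! i) = i" "qs ! i \<in> states A"
          using position_eq[OF qs(1)] length_qs qs(2) by auto
        then show "i \<in> pos ` states A" by force
      qed
    qed (auto simp: pos_less)
    then have "?l \<longleftrightarrow> (\<forall>q\<in>states A. rec_nat (pos q) (\<lambda>_ r. step d r j) m = pos q)"
      by (simp add: list_all_iff atLeast0LessThan)
    also have "\<dots> \<longleftrightarrow> ?r"
      using iter position_eq_iff[OF qs(1)] qs(2) by auto
    finally show ?thesis .
  qed
  then have "order_of d n j =
      hd (filter (\<lambda>m. \<forall>q\<in>states A. run A q (replicate m (as ! j)) = q) [1..<Suc (fact n)])"
    by (simp add: order_of_def map_Suc_upt del: upt_Suc)
  also have "\<dots> = L (as ! j)"
  proof -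
    let ?P = "\<lambda>m. \<forall>q\<in>states A. run A q (replicate m (as ! j)) = q"
    \<comment> \<open>Splits the candidates at the order: everything before it is filtered out, so
      the order becomes the head.\<close>
    have "[1..<Suc (fact n)] = [1..<L (as ! j)] @ L (as ! j) # [Suc (L (as ! j))..<Suc (fact n)]"
      using letter_order(1,3)[OF a]
        upt_add_eq_append[of 1 "L (as ! j)" "Suc (fact n) - L (as ! j)"]
      by (simp add: upt_conv_Cons del: upt_Suc)
    moreover have "\<not> ?P m" if "0 < m" "m < L (as ! j)" for m
      using not_less_Least[of m "\<lambda>m. 0 < m \<and> ?P m"] that unfolding letter_order_def by blast
    then have "filter ?P [1..<L (as ! j)] = []"
      by (auto simp: filter_empty_conv)
    moreover have "?P (L (as ! j))"
      using letter_order(2)[OF a] by blast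
    ultimately show ?thesis by simp
  qed
  finally show ?thesis .
qed

section \<open>Parikh vectors as lists\<close>

definition vec :: "('a \<Rightarrow> nat) \<Rightarrow> nat list" where
  "vec v = map v as"

lemma vec_eq_iff: "vec v = vec w \<longleftrightarrow> (\<forall>a\<in>alphabet A. v a = w a)"
  using as(2) by (auto simp: vec_def)

lemma vec_upd: "j < k \<Longrightarrow> vec (v(as ! j := x)) = map (\<lambda>i. if i = j then x else entry (vec v) i) [0..<k]"
  using as(1) by (auto intro!: nth_equalityI simp: vec_def entry_nth nth_eq_iff_index_eq)

lemma increment_vec: "j < k \<Longrightarrow> increment k (vec v) j = vec (v(as ! j := Suc (v (as ! j))))"
  by (auto simp: vec_upd increment_def) (simp add: vec_def entry_nth)

lemma wrap_vec: "j < k \<Longrightarrow> wrap d n k (vec w) j = vec (advance w (as ! j))"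
  unfolding advance_def by (simp add: vec_upd wrap_def) (auto simp: order_of_d vec_def entry_nth)

lemma sum_vec: "sum_list (vec v) = sum v (alphabet A)"
  using as by (simp add: vec_def sum_list_distinct_conv_sum_set)

lemma sum_vec_Suc:
  "a \<in> alphabet A \<Longrightarrow> sum_list (vec (v(a := Suc (v a)))) = Suc (sum_list (vec v))"
proof -
  assume a: "a \<in> alphabet A"
  have "sum (v(a := Suc (v a))) (alphabet A - {a}) = sum v (alphabet A - {a})"
    by (rule sum.cong) auto
  then show ?thesis
    using sum.remove[OF finite_alphabet a, of v]
      sum.remove[OF finite_alphabet a, of "v(a := Suc (v a))"] by (simp add: sum_vec)
qed

lemma set_successors:
  assumes "q \<in> states A" "j < k"
  shows "x \<in> set (successors d k (pos (start A)) fin (vec v, pos q) j) \<longleftrightarrow>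
    x = (vec (v(as ! j := Suc (v (as ! j)))), pos (trans A q (as ! j))) \<or>
    trans A q (as ! j) \<in> final A \<and> x = (vec (v(as ! j := Suc (v (as ! j)))), pos (start A))"
  using assms
  by (simp add: successors_def increment_vec step_d entry_fin trans_in as_nth del: fun_upd_apply)

text \<open>Each rule that reads a letter raises the coordinate sum by one, so rounds of the program
  match steps of \<open>reach\<close>.\<close>

lemma set_reachable_list:
  "set (reachable_list d k (pos (start A)) fin m) =
    {(vec v, pos q) | v q. reach A v q \<and> sum_list (vec v) = m}" (is "?R m = ?S m")
proof (induction m)
  case 0
  \<comment> \<open>With coordinate sum zero no letter was read, which leaves only the rule
    \<open>init\<close>.\<close>
  have init: "v = (\<lambda>_. 0) \<and> q = start A" if "reach A v q" "sum_list (vec v) = 0" for v q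
    using that(1)
  proof cases
    case (move u p a)
    with that(2) sum_vec_Suc[of a u] show ?thesis by simp
  next
    case (restart u p a)
    with that(2) sum_vec_Suc[of a u] show ?thesis by simp
  qed simp
  have "?S 0 \<subseteq> {(vec (\<lambda>_. 0), pos (start A))}"
    by (auto dest: init)
  moreover have "(vec (\<lambda>_. 0), pos (start A)) \<in> ?S 0"
    using reach.init[of A] sum_vec[of "\<lambda>_. 0"] by auto
  ultimately have "?S 0 = {(vec (\<lambda>_. 0), pos (start A))}"
    by blast
  then show ?case by (simp add: reachable_list_def vec_def map_replicate_const)
next
  case (Suc m)
  let ?next = "\<lambda>p j. set (successors d k (pos (start A)) fin p j)"
  have "?R (Suc m) = (\<Union>p\<in>?R m. \<Union>j<k. ?next p j)"
    by (simp add: reachable_list_def atLeast0LessThan)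
  then have R: "?R (Suc m) = (\<Union>p\<in>?S m. \<Union>j<k. ?next p j)"
    by (simp only: Suc.IH)
  show ?case
  proof (intro equalityI subsetI)
    fix x assume "x \<in> ?R (Suc m)"
    then obtain v q j where vq: "reach A v q" "sum_list (vec v) = m" "j < k"
      "x \<in> ?next (vec v, pos q) j"
      unfolding R by blast
    note q = reach_in_states[OF vq(1)] and a = as_nth[OF vq(3)]
    let ?v = "v(as ! j := Suc (v (as ! j)))"
    have sum: "sum_list (vec ?v) = Suc m"
      using sum_vec_Suc[OF a] vq(2) by (simp only:)
    from vq(4)[unfolded set_successors[OF q vq(3)]] show "x \<in> ?S (Suc m)"
    proof
      assume "x = (vec ?v, pos (trans A q (as ! j)))"
      with sum reach.move[OF vq(1) a] show ?thesis by blast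
    next
      assume *: "trans A q (as ! j) \<in> final A \<and> x = (vec ?v, pos (start A))"
      with reach.restart[OF vq(1) a] have "reach A ?v (start A)" by blast
      with sum * show ?thesis by blast
    qed
  next
    fix x assume "x \<in> ?S (Suc m)"
    then obtain v q where x: "x = (vec v, pos q)" and vq: "reach A v q" "sum_list (vec v) = Suc m"
      by blast
    have in_R: "x \<in> ?R (Suc m)"
      if u: "reach A u p" "a \<in> alphabet A" "v = u(a := Suc (u a))"
        "q = trans A p a \<or> trans A p a \<in> final A \<and> q = start A" for u p a
    proof -
      have a: "position as a < k" "as ! position as a = a"
        using position_less[OF as(1)] nth_position[OF as(1)] u(2) as(2) by auto
      have "x \<in> ?next (vec u, pos p) (position as a)"
        unfolding set_successors[OF reach_in_states[OF u(1)] a(1)] a(2) x u(3)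
        using u(4) by blast
      moreover have "sum_list (vec u) = m"
        using vq(2) sum_vec_Suc[OF u(2), of u] unfolding u(3) by simp
      ultimately show ?thesis
        unfolding R using u(1) a(1) by blast
    qed
    from vq(1) show "x \<in> ?R (Suc m)"
    proof cases
      case init
      with vq(2) show ?thesis by (simp add: sum_vec)
    next
      case (move u p a)
      with in_R[OF move(3,4,1)] show ?thesis by blast
    next
      case (restart u p a)
      with in_R[OF restart(3,4,1)] show ?thesis by blast
    qed
  qed
qed

text \<open>Both \<open>v\<close> and the vectors occurring in \<open>reach\<close> vanish outside
  the alphabet, so the list \<open>vec v\<close> determines them.\<close>

lemma accepting_vec:
  assumes "\<And>b. b \<notin> alphabet A \<Longrightarrow> v b = 0"
  shows "accepting d k (pos (start A)) fin (vec v) \<longleftrightarrow> reached A v \<inter> final A \<noteq> {}"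
proof -
  have "w = v" if "reach A w q" "vec w = vec v" for w q
    using that reach_outside[OF that(1)] assms by (metis ext vec_eq_iff)
  moreover have "entry fin (pos q) = 1 \<longleftrightarrow> q \<in> final A" if "reach A w q" for w q
    using entry_fin[OF reach_in_states[OF that]] by simp
  ultimately show ?thesis
    unfolding accepting_def list_ex_iff set_reachable_list by (fastforce simp: reached_def)
qed

section \<open>The automaton for the commutative closure\<close>

abbreviation "rs \<equiv> state_names d n k"

lemma vectors_eq: "vectors d n k = product_lists (map (\<lambda>a. [0..<n * L a]) as)"
proof -
  have "map (\<lambda>j. [0..<n * order_of d n j]) [0..<k] = map (\<lambda>a. [0..<n * L a]) as"
    by (auto intro!: nth_equalityI simp: order_of_d)
  then show ?thesis by (simp add: vectors_def)
qed

lemma vec_in_vectors: "vec v \<in> set (vectors d n k) \<longleftrightarrow> (\<forall>a\<in>alphabet A. v a < n * L a)"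
proof -
  have "vec v \<in> set (vectors d n k) \<longleftrightarrow> list_all (\<lambda>a. v a < n * L a) as"
    by (auto simp: vectors_eq product_lists_set vec_def list_all2_map1 list_all2_map2
        list_all2_same list_all_iff)
  then show ?thesis using as(2) by (simp add: list_all_iff)
qed

lemma vectors_cases:
  assumes "xs \<in> set (vectors d n k)"
  obtains v where "xs = vec v" "\<And>b. b \<notin> alphabet A \<Longrightarrow> v b = 0"
    "\<And>a. a \<in> alphabet A \<Longrightarrow> v a < n * L a"
proof -
  have len: "length xs = k"
    using in_set_product_lists_length assms unfolding vectors_eq by force
  define v where "v = (\<lambda>b. if b \<in> alphabet A then xs ! position as b else 0)"
  have "xs = vec v"
    using len position_eq[OF as(1)] as_nth by (auto intro!: nth_equalityI simp: v_def vec_def)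
  moreover from this have "\<forall>a\<in>alphabet A. v a < n * L a"
    using assms vec_in_vectors by simp
  ultimately show ?thesis using that by (auto simp: v_def)
qed

lemma distinct_rs: "distinct rs"
proof -
  have "distinct (vectors d n k)"
    unfolding vectors_eq by (rule distinct_product_lists) auto
  then show ?thesis
    by (auto simp: state_names_def distinct_map inj_on_def list_encode_eq)
qed

text \<open>Each letter \<open>a\<close> contributes \<open>n * L a\<close> counter values; the
  summand 1 is the initial state.\<close>

lemma length_rs: "length rs = n ^ k * (\<Prod>j<k. L (as ! j)) + 1"
proof -
  have "length (product_lists (map f ys)) = (\<Prod>y\<leftarrow>ys. length (f y))" for f :: "'a \<Rightarrow> nat list" and ys
    by (induction ys) (auto simp: length_concat o_def sum_list_triv)
  then have "length (vectors d n k) = (\<Prod>a\<leftarrow>as. n * L a)"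
    by (simp add: vectors_eq)
  also have "\<dots> = (\<Prod>j<k. n * L (as ! j))"
    by (simp add: prod.list_conv_set_nth atLeast0LessThan)
  also have "\<dots> = n ^ k * (\<Prod>j<k. L (as ! j))"
    by (simp add: prod.distrib)
  finally show ?thesis by (simp add: state_names_def)
qed

text \<open>The automaton behind \<open>closure_code\<close>, on state names instead of their
  positions. Every transition yields a successor, so the initial state 0 is never entered
  again.\<close>

definition B :: "('a, nat) automaton" where
  "B = \<lparr>alphabet = alphabet A, states = set rs,
     trans = (\<lambda>q a. Suc (list_encode (wrap d n k (vector_of k q) (position as a)))),
     start = 0,
     final = {q \<in> set rs. q = 0 \<or> accepting d k (pos (start A)) fin (vector_of k q)}\<rparr>"

lemma alphabet_B: "alphabet B = alphabet A" and start_B: "start B = 0" and states_B: "states B = set rs"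
  by (simp_all add: B_def)

lemma vector_of_simps [simp]:
  "vector_of k 0 = vec (\<lambda>_. 0)" "vector_of k (Suc (list_encode v)) = v"
  by (simp_all add: vector_of_def vec_def map_replicate_const)

lemma trans_B:
  assumes "a \<in> alphabet A" "vector_of k q = vec v"
  shows "trans B q a = Suc (list_encode (vec (advance v a)))"
proof -
  have "position as a < k" "as ! position as a = a"
    using position_less nth_position as assms(1) by metis+
  then show ?thesis by (simp add: B_def assms(2) wrap_vec)
qed

lemma Suc_encode_in_rs: "Suc (list_encode x) \<in> set rs \<longleftrightarrow> x \<in> set (vectors d n k)"
  by (auto simp: state_names_def list_encode_eq)

lemma vector_of_rs:
  assumes "q \<in> set rs"
  obtains v where "vector_of k q = vec v" "\<And>b. b \<notin> alphabet A \<Longrightarrow> v b = 0"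
    "\<And>a. a \<in> alphabet A \<Longrightarrow> v a < n * L a"
proof (cases "q = 0")
  case True
  show ?thesis
    using that[of "\<lambda>_. 0"] True card_states_pos letter_order(1) by simp
next
  case False
  with assms obtain x where "q = Suc (list_encode x)" "x \<in> set (vectors d n k)"
    by (auto simp: state_names_def)
  then show ?thesis using vectors_cases that by (metis vector_of_simps(2))
qed

lemma trans_B_in:
  assumes "q \<in> set rs" "a \<in> alphabet A"
  shows "trans B q a \<in> set rs"
proof -
  from vector_of_rs[OF assms(1)] obtain v where
    v: "vector_of k q = vec v" "\<And>a. a \<in> alphabet A \<Longrightarrow> v a < n * L a" by metis
  have "advance v a b < n * L b" if "b \<in> alphabet A" for b
    using that advance_bound[OF assms(2)] v(2) by (cases "b = a") (auto simp: advance_def)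
  then show ?thesis
    unfolding trans_B[OF assms(2) v(1)] Suc_encode_in_rs vec_in_vectors by blast
qed

lemma automaton_B: "automaton B"
  using trans_B_in finite_alphabet
  by (auto simp: automaton_def B_def) (auto simp: state_names_def)

lemma run_B:
  assumes "u \<in> lists (alphabet A)"
  shows "run B 0 u = (if u = [] then 0 else Suc (list_encode (vec (foldl advance (\<lambda>_. 0) u))))"
  using assms
proof (induction u rule: rev_induct)
  case (snoc a u)
  have "vector_of k (run B 0 u) = vec (foldl advance (\<lambda>_. 0) u)"
    using snoc by simp
  with snoc.prems show ?case by (simp add: trans_B)
qed simp

lemma lang_B: "lang B = perm as (iterated_shuffle (lang A))"
proof -
  have "run B 0 u \<in> final B \<longleftrightarrow> u = [] \<or> reached A (count_list u) \<inter> final A \<noteq> {}"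
    if u: "u \<in> lists (alphabet A)" for u
  proof (cases "u = []")
    case True
    then show ?thesis by (simp add: B_def state_names_def)
  next
    case False
    have outside: "foldl advance (\<lambda>_. 0) u b = 0" if "b \<notin> alphabet A" for b
      using u that by (induction u rule: rev_induct) (auto simp: advance_def)
    have "run B 0 u \<in> set rs"
      using u by (induction u rule: rev_induct) (simp_all add: trans_B_in, simp add: state_names_def)
    then show ?thesis
      using False run_B[OF u] accepting_vec[OF outside] reached_count_list[OF u]
      by (simp add: B_def)
  qed
  then show ?thesis
    unfolding lang_def[of B] using perm_iterated_shuffle[OF as(2)] by (auto simp: alphabet_B start_B)
qed

text \<open>All transitions stay within the distinct list \<open>rs\<close>, so the computed indices
  are the positions required by \<open>automaton_code\<close>.\<close>

lemma closure_code_eq: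
  "closure_code k n (pos (start A)) fin d = automaton_code as rs B"
proof -
  have "position rs 0 = 0"
    by (rule position_eq[OF distinct_rs]) (simp_all add: state_names_def)
  moreover have "index_of rs (Suc (list_encode (wrap d n k (vector_of k q) j))) =
      position rs (trans B q (as ! j))" if "q \<in> set rs" "j < k" for q j
  proof -
    have eq: "trans B q (as ! j) = Suc (list_encode (wrap d n k (vector_of k q) j))"
      using that(2) by (simp add: B_def position_eq[OF as(1)])
    with trans_B_in[OF that(1) as_nth[OF that(2)]] show ?thesis
      by (simp add: index_of_eq_position[OF distinct_rs])
  qed
  then have "map (\<lambda>j. index_of rs (Suc (list_encode (wrap d n k (vector_of k q) j)))) [0..<k] =
      map (\<lambda>a. position rs (trans B q a)) as" if "q \<in> set rs" for q
    using that by (auto intro!: nth_equalityI)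
  moreover have "q \<in> final B \<longleftrightarrow> q = 0 \<or> accepting d k (pos (start A)) fin (vector_of k q)"
    if "q \<in> set rs" for q using that by (simp add: B_def)
  ultimately show ?thesis
    unfolding closure_code_def automaton_code_def by (simp add: start_B cong: map_cong)
qed

end

theorem theorem9:
  "\<exists>f. computable f \<and>
     (\<forall>(A :: ('a, 'q) automaton) as qs.
        permutation_automaton A \<and> enumerates as (alphabet A) \<and> enumerates qs (states A) \<longrightarrow>
        (\<exists>(B :: ('a, nat) automaton) rs.
           automaton B \<and> alphabet B = alphabet A \<and>
           lang B = perm as (iterated_shuffle (lang A)) \<and>
           card (states B) \<le>
             card (states A) ^ length as * (\<Prod>j<length as. letter_order A (as ! j)) + 1 \<and>
           enumerates rs (states B) \<and>
           f (automaton_code as qs A) = automaton_code as rs B))"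
proof (intro exI[of _ closure_program] conjI computable_closure_program allI impI, elim conjE)
  fix A :: "('a, 'q) automaton" and as qs
  assume "permutation_automaton A" "enumerates as (alphabet A)" "enumerates qs (states A)"
  then interpret enumerated_automaton A as qs
    by unfold_locales
  \<comment> \<open>The state names are distinct, so the bound is even attained.\<close>
  have "card (states B) = length rs" "enumerates rs (states B)"
    using distinct_rs by (simp_all add: states_B distinct_card enumerates_def)
  moreover have "closure_program (automaton_code as qs A) = automaton_code as rs B"
    by (simp only: closure_program_code closure_code_eq)
  ultimately show "\<exists>(B :: ('a, nat) automaton) rs.
      automaton B \<and> alphabet B = alphabet A \<and>
      lang B = perm as (iterated_shuffle (lang A)) \<and>
      card (states B) \<le>
        card (states A) ^ length as * (\<Prod>j<length as. letter_order A (as ! j)) + 1 \<and>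
      enumerates rs (states B) \<and>
      closure_program (automaton_code as qs A) = automaton_code as rs B"
    using automaton_B lang_B length_rs alphabet_B by (intro exI[of _ B] exI[of _ rs]) auto
qed

end
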